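(* The symmetric geometric rank of the symmetrized part $sM_{\langle n+1\rangle}$ of the matrix multiplication tensor is $$\mathrm{sgr}(sM_{\langle n+1\rangle})=\frac{(n+1)^2}{2}.$$
   Context: Work over $\mathbb{C}$. The symmetrized part of the matrix multiplication tensor is $sM_{\langle n+1\rangle}(A,B,C):=\frac12[\mathrm{trace}(ABC)+\mathrm{trace}(BAC)]\in\mathrm{Sym}^3\mathbb{C}^{(n+1)^2}$, where $A,B,C$ are complex matrices of size $n+1$; its associated homogeneous cubic polynomial is $A\mapsto\mathrm{trace}(A^3)$ on the space $M_{n+1}(\mathbb{C})\cong\mathbb{C}^{(n+1)^2}$ of $(n+1)\times(n+1)$ matrices. For a symmetric tensor with associated homogeneous polynomial $F\in\mathbb{C}[x_0,\dots,x_m]$, the symmetric geometric rank is $\mathrm{sgr}(F)=\mathrm{codim}_{\mathbb{P}^m}\{[x]\in\mathbb{P}^m:\frac{\partial F}{\partial x_i}(x)=0,\ i=0,\dots,m\}$, i.e. the codimension in $\mathbb{P}^m$ of the singular locus of the hypersurface defined by $F$.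
   Formalization: The stated formula holds for odd n; for even n, (n+1)²/2 is not an integer, so it cannot be a codimension, and the value proved there is ((n+1)²+1)/2, with the empty singular locus at n = 0 given dimension −1. *)

theory Defs
  imports "HOL-Analysis.Analysis" "HOL-Library.Poly_Mapping"
begin

section \<open>Polynomials over the complex numbers in finitely many variables\<close>

text \<open>The variables are indexed by a finite type; a polynomial is a finitely supported map from
  exponent vectors to coefficients, with the ring structure of \<^theory>\<open>HOL-Library.Poly_Mapping\<close>.\<close>

type_synonym 'i cpoly = "('i \<Rightarrow>\<^sub>0 nat) \<Rightarrow>\<^sub>0 complex"

definition pvar :: "'i \<Rightarrow> 'i cpoly" where
  "pvar i = Poly_Mapping.single (Poly_Mapping.single i 1) 1"

definition pconst :: "complex \<Rightarrow> 'i cpoly" where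
  "pconst c = Poly_Mapping.single 0 c"

definition peval :: "'i::finite cpoly \<Rightarrow> complex ^ 'i \<Rightarrow> complex" where
  "peval f x = (\<Sum>m\<in>Poly_Mapping.keys f.
     Poly_Mapping.lookup f m * (\<Prod>i\<in>UNIV. (x $ i) ^ Poly_Mapping.lookup m i))"

text \<open>The zero polynomial is homogeneous of every degree.\<close>

definition homogeneous :: "nat \<Rightarrow> 'i::finite cpoly \<Rightarrow> bool" where
  "homogeneous d f \<longleftrightarrow>
     (\<forall>m\<in>Poly_Mapping.keys f. (\<Sum>i\<in>UNIV. Poly_Mapping.lookup m i) = d)"

text \<open>Formal partial derivative. Where the exponent of the variable is 0 the subtraction is
  truncated, but then the coefficient vanishes.\<close>

definition partial_deriv :: "'i \<Rightarrow> 'i cpoly \<Rightarrow> 'i cpoly" where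
  "partial_deriv i f = (\<Sum>m\<in>Poly_Mapping.keys f.
     Poly_Mapping.single (m - Poly_Mapping.single i 1)
       (of_nat (Poly_Mapping.lookup m i) * Poly_Mapping.lookup f m))"

lemma cpoly_expand:
  fixes f :: "'i cpoly"
  shows "f = (\<Sum>m\<in>Poly_Mapping.keys f. Poly_Mapping.single m (Poly_Mapping.lookup f m))"
proof (rule poly_mapping_eqI)
  fix k
  show "Poly_Mapping.lookup f k = Poly_Mapping.lookup
    (\<Sum>m\<in>Poly_Mapping.keys f. Poly_Mapping.single m (Poly_Mapping.lookup f m)) k"
    by (simp add: lookup_sum lookup_single when_def in_keys_iff)
qed

lemma peval_superset:
  assumes "finite K" "Poly_Mapping.keys f \<subseteq> K"
  shows "peval f x = (\<Sum>m\<in>K. Poly_Mapping.lookup f m * (\<Prod>i\<in>UNIV. (x $ i) ^ Poly_Mapping.lookup m i))"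
  unfolding peval_def by (rule sum.mono_neutral_left) (use assms in \<open>auto simp: in_keys_iff\<close>)

lemma peval_0 [simp]: "peval 0 x = 0"
  by (simp add: peval_def)

lemma peval_add: "peval (f + g) x = peval f x + peval g x"
proof -
  let ?K = "Poly_Mapping.keys f \<union> Poly_Mapping.keys g"
  have "finite ?K" "Poly_Mapping.keys (f + g) \<subseteq> ?K"
    using keys_add[of f g] by auto
  then show ?thesis
    by (simp add: peval_superset[of ?K] lookup_add algebra_simps sum.distrib)
qed

lemma peval_sum: "peval (\<Sum>a\<in>A. f a) x = (\<Sum>a\<in>A. peval (f a) x)"
  by (induction A rule: infinite_finite_induct) (simp_all add: peval_add)

lemma peval_single:
  "peval (Poly_Mapping.single m c) x = c * (\<Prod>i\<in>UNIV. (x $ i) ^ Poly_Mapping.lookup m i)"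
  by (cases "c = 0") (simp_all add: peval_def)

lemma peval_mult: "peval (f * g) x = peval f x * peval g x"
proof -
  let ?s = "\<lambda>h m. Poly_Mapping.single m (Poly_Mapping.lookup h m)"
  have "f * g = (\<Sum>m\<in>Poly_Mapping.keys f. ?s f m) * (\<Sum>m\<in>Poly_Mapping.keys g. ?s g m)"
    using cpoly_expand[of f] cpoly_expand[of g] by simp
  also have "\<dots> = (\<Sum>m\<in>Poly_Mapping.keys f. \<Sum>n\<in>Poly_Mapping.keys g. ?s f m * ?s g n)"
    by (simp add: sum_product)
  finally have "peval (f * g) x = 
      (\<Sum>m\<in>Poly_Mapping.keys f. \<Sum>n\<in>Poly_Mapping.keys g. peval (?s f m * ?s g n) x)"
    by (simp add: peval_sum)
  also have "\<dots> = peval f x * peval g x"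
    unfolding peval_def[of f] peval_def[of g] sum_product
    by (intro sum.cong refl)
       (simp add: mult_single peval_single lookup_add power_add prod.distrib algebra_simps)
  finally show ?thesis .
qed

lemma peval_pvar [simp]: "peval (pvar i) x = x $ i"
proof -
  have "(\<Prod>j\<in>UNIV. (x $ j) ^ Poly_Mapping.lookup (Poly_Mapping.single i (1::nat)) j)
      = (\<Prod>j\<in>UNIV. if j = i then x $ j else 1)"
    by (rule prod.cong) (auto simp: lookup_single when_def)
  then show ?thesis by (simp add: pvar_def peval_single)
qed

lemma peval_pconst [simp]: "peval (pconst c) x = c"
  by (simp add: pconst_def peval_single)

lemma peval_scale:
  assumes "homogeneous d f"
  shows "peval f (c *s x) = c ^ d * peval f x"
proof -
  have "(\<Prod>i\<in>UNIV. ((c *s x) $ i) ^ Poly_Mapping.lookup m i)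
      = c ^ d * (\<Prod>i\<in>UNIV. (x $ i) ^ Poly_Mapping.lookup m i)"
    if "m \<in> Poly_Mapping.keys f" for m
    using assms that
    by (simp add: homogeneous_def power_mult_distrib prod.distrib flip: power_sum)
  then show ?thesis
    by (simp add: peval_def sum_distrib_left algebra_simps)
qed

lemma homogeneous_mult:
  assumes "homogeneous d f" "homogeneous e g"
  shows "homogeneous (d + e) (f * g)"
  unfolding homogeneous_def
proof
  fix k assume "k \<in> Poly_Mapping.keys (f * g)"
  then obtain a b where "k = a + b" "a \<in> Poly_Mapping.keys f" "b \<in> Poly_Mapping.keys g"
    using keys_mult[of f g] by auto
  then show "(\<Sum>i\<in>UNIV. Poly_Mapping.lookup k i) = d + e"
    using assms by (simp add: homogeneous_def lookup_add sum.distrib)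
qed


section \<open>Projective space with its Zariski topology\<close>

text \<open>The points of projective space of dimension \<open>CARD('i) - 1\<close> are the lines through the origin.
  A homogeneous polynomial vanishes at such a point iff it vanishes on the line.\<close>

definition proj_space :: "(complex ^ 'i) set set" where
  "proj_space = {vec.span {x} | x. x \<noteq> 0}"

definition proj_zeros :: "'i::finite cpoly set \<Rightarrow> (complex ^ 'i) set set" where
  "proj_zeros S = {L \<in> proj_space. \<forall>f\<in>S. \<forall>x\<in>L. peval f x = 0}"

definition zariski :: "(complex ^ 'i::finite) set topology" where
  "zariski = topology (\<lambda>U. \<exists>S. (\<forall>f\<in>S. \<exists>d. homogeneous d f) \<and> U = proj_space - proj_zeros S)"

lemma peval_line:
  assumes "homogeneous d f" "x \<noteq> 0"
  shows "(\<forall>y\<in>vec.span {x}. peval f y = 0) \<longleftrightarrow> peval f x = 0"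
  using assms vec.span_base[of x "{x}"] by (auto simp: vec.span_singleton peval_scale)

lemma istopology_zariski:
  "istopology (\<lambda>U. \<exists>S. (\<forall>f\<in>S. \<exists>d. homogeneous d (f :: 'i::finite cpoly)) \<and>
     U = proj_space - proj_zeros S)"
  (is "istopology ?op")
  unfolding istopology_def
proof (intro conjI allI impI)
  fix U V assume "?op U" "?op V"
  then obtain S T where S: "\<forall>f\<in>S. \<exists>d. homogeneous d f" "U = proj_space - proj_zeros S"
    and T: "\<forall>f\<in>T. \<exists>d. homogeneous d f" "V = proj_space - proj_zeros T" by blast
  let ?R = "{f * g | f g. f \<in> S \<and> g \<in> T}"
  have R: "\<forall>h\<in>?R. \<exists>d. homogeneous d h"
    using S(1) T(1) homogeneous_mult by blast
  have mem: "vec.span {x} \<in> proj_zeros Q \<longleftrightarrow> (\<forall>f\<in>Q. peval f x = 0)"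
    if "x \<noteq> 0" "\<forall>f\<in>Q. \<exists>d. homogeneous d f" for Q and x :: "complex ^ 'i"
    using that peval_line unfolding proj_zeros_def proj_space_def by blast
  have "(\<forall>h\<in>?R. peval h x = 0) \<longleftrightarrow> (\<forall>f\<in>S. \<forall>g\<in>T. peval (f * g) x = 0)" for x
    by blast
  then have "(\<forall>h\<in>?R. peval h x = 0) \<longleftrightarrow> (\<forall>f\<in>S. peval f x = 0) \<or> (\<forall>g\<in>T. peval g x = 0)" for x
    unfolding peval_mult mult_eq_0_iff by blast
  then have "vec.span {x} \<in> proj_zeros ?R \<longleftrightarrow> vec.span {x} \<in> proj_zeros S \<union> proj_zeros T"
    if "x \<noteq> 0" for x :: "complex ^ 'i"
    unfolding Un_iff mem[OF that R] mem[OF that S(1)] mem[OF that T(1)] by simp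
  then have "L \<in> proj_zeros ?R \<longleftrightarrow> L \<in> proj_zeros S \<union> proj_zeros T"
    if "L \<in> proj_space" for L :: "(complex ^ 'i) set"
    using that unfolding proj_space_def by blast
  moreover have "proj_zeros Q \<subseteq> proj_space" for Q :: "'i cpoly set"
    by (auto simp: proj_zeros_def)
  ultimately have "proj_zeros ?R = proj_zeros S \<union> proj_zeros T"
    by blast
  then have "U \<inter> V = proj_space - proj_zeros ?R"
    using S(2) T(2) by auto
  with R show "?op (U \<inter> V)" by blast
next
  fix K assume "\<forall>U\<in>K. ?op U"
  then obtain S where S: "\<And>U. U \<in> K \<Longrightarrow> (\<forall>f\<in>S U. \<exists>d. homogeneous d f) \<and> U = proj_space - proj_zeros (S U)"
    by metis
  have "\<Union>K = proj_space - proj_zeros (\<Union>U\<in>K. S U)"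
  proof (intro set_eqI iffI)
    fix L assume "L \<in> \<Union>K"
    then obtain U where U: "U \<in> K" "L \<in> U" by blast
    then have "L \<in> proj_space - proj_zeros (S U)" using S by blast
    then show "L \<in> proj_space - proj_zeros (\<Union>U\<in>K. S U)"
      using U by (auto simp: proj_zeros_def)
  next
    fix L assume L: "L \<in> proj_space - proj_zeros (\<Union>U\<in>K. S U)"
    then obtain U where U: "U \<in> K" "L \<in> proj_space - proj_zeros (S U)"
      by (auto simp: proj_zeros_def)
    then show "L \<in> \<Union>K" using S[OF U(1)] by blast
  qed
  moreover have "\<forall>f\<in>(\<Union>U\<in>K. S U). \<exists>d. homogeneous d f" using S by blast
  ultimately show "?op (\<Union>K)" by blast
qed


section \<open>Krull dimension and codimension\<close>

definition irreducible_closed :: "'a topology \<Rightarrow> 'a set \<Rightarrow> bool" where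
  "irreducible_closed T Z \<longleftrightarrow> closedin T Z \<and> Z \<noteq> {} \<and>
     (\<forall>A B. closedin T A \<and> closedin T B \<and> Z = A \<union> B \<longrightarrow> Z = A \<or> Z = B)"

text \<open>The supremum of the lengths of chains of irreducible closed subsets. The inserted value is
  the convention that the empty space has dimension \<open>-1\<close>, so that the singular locus of a smooth
  hypersurface in projective \<open>m\<close>-space has codimension \<open>m + 1\<close>; it has no effect on nonempty
  spaces.\<close>

definition krull_dim :: "'a topology \<Rightarrow> ereal" where
  "krull_dim T = Sup (insert (- 1) {ereal (real k) | k. \<exists>Z.
     (\<forall>j\<le>k. irreducible_closed T (Z j)) \<and> (\<forall>j<k. Z j \<subset> Z (Suc j))})"

definition proj_codim :: "(complex ^ 'i::finite) set set \<Rightarrow> ereal" where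
  "proj_codim X = krull_dim (zariski :: (complex ^ 'i) set topology)
     - krull_dim (subtopology zariski X)"


section \<open>Symmetric geometric rank\<close>

definition sing_locus :: "'i::finite cpoly \<Rightarrow> (complex ^ 'i) set set" where
  "sing_locus F = proj_zeros (range (\<lambda>i. partial_deriv i F))"

text \<open>A tensor of order three is given as a trilinear form. The polynomial of degree three
  associated with a symmetric one is that representing \<open>x \<mapsto> T x x x\<close> (see
  \<open>peval_cubic_of\<close>).\<close>

definition cubic_of :: "(complex ^ 'i \<Rightarrow> complex ^ 'i \<Rightarrow> complex ^ 'i \<Rightarrow> complex) \<Rightarrow> 'i::finite cpoly" where
  "cubic_of T = (\<Sum>p\<in>UNIV. \<Sum>q\<in>UNIV. \<Sum>r\<in>UNIV.
     pconst (T (axis p 1) (axis q 1) (axis r 1)) * pvar p * pvar q * pvar r)"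

definition sgr :: "(complex ^ 'i \<Rightarrow> complex ^ 'i \<Rightarrow> complex ^ 'i::finite \<Rightarrow> complex) \<Rightarrow> ereal" where
  "sgr T = proj_codim (sing_locus (cubic_of T))"

definition vec_to_mat :: "complex ^ ('n::finite \<times> 'n) \<Rightarrow> complex ^ 'n ^ 'n" where
  "vec_to_mat v = (\<chi> i j. v $ (i, j))"

definition sM_mat :: "complex ^ 'n ^ 'n \<Rightarrow> complex ^ 'n ^ 'n \<Rightarrow> complex ^ 'n ^ 'n \<Rightarrow> complex" where
  "sM_mat A B C = 1 / 2 * (trace (A ** B ** C) + trace (B ** A ** C))"

definition sM :: "complex ^ ('n::finite \<times> 'n) \<Rightarrow> complex ^ ('n \<times> 'n) \<Rightarrow> complex ^ ('n \<times> 'n) \<Rightarrow> complex" where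
  "sM a b c = sM_mat (vec_to_mat a) (vec_to_mat b) (vec_to_mat c)"

lemma peval_cubic_of:
  fixes T :: "complex ^ 'i \<Rightarrow> complex ^ 'i \<Rightarrow> complex ^ 'i::finite \<Rightarrow> complex"
  assumes "\<And>y z. Vector_Spaces.linear (*s) (*) (\<lambda>x. T x y z)"
    "\<And>x z. Vector_Spaces.linear (*s) (*) (\<lambda>y. T x y z)"
    "\<And>x y. Vector_Spaces.linear (*s) (*) (\<lambda>z. T x y z)"
  shows "peval (cubic_of T) x = T x x x"
proof -
  have e: "f x = (\<Sum>p\<in>UNIV. x $ p * f (axis p 1))"
    if "Vector_Spaces.linear (*s) (*) f" for f :: "complex ^ 'i \<Rightarrow> complex"
  proof -
    interpret f: Vector_Spaces.linear "(*s)" "(*)" f by (rule that)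
    have "f x = f (\<Sum>p\<in>UNIV. x $ p *s axis p 1)" by (simp add: basis_expansion)
    also have "\<dots> = (\<Sum>p\<in>UNIV. x $ p * f (axis p 1))" by (simp add: f.sum f.scale)
    finally show ?thesis .
  qed
  have "T x x x = (\<Sum>p\<in>UNIV. x $ p * T (axis p 1) x x)"
    by (rule e[OF assms(1)])
  also have "\<dots> = (\<Sum>p\<in>UNIV. x $ p * (\<Sum>q\<in>UNIV. x $ q * T (axis p 1) (axis q 1) x))"
    by (subst e[OF assms(2)]) simp
  also have "\<dots> = (\<Sum>p\<in>UNIV. x $ p * (\<Sum>q\<in>UNIV. x $ q *
      (\<Sum>r\<in>UNIV. x $ r * T (axis p 1) (axis q 1) (axis r 1))))"
    by (subst e[OF assms(3)]) simp
  finally show ?thesis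
    by (simp add: cubic_of_def peval_sum peval_mult sum_distrib_left algebra_simps)
qed

lemma trace_vec_to_mat_add:
  "trace (vec_to_mat (a + b) ** B) = trace (vec_to_mat a ** B) + trace (vec_to_mat b ** B)"
  by (simp add: trace_def matrix_matrix_mult_def vec_to_mat_def distrib_right sum.distrib)

lemma trace_vec_to_mat_scale:
  "trace (vec_to_mat (c *s a) ** B) = c * trace (vec_to_mat a ** B)"
  by (simp add: trace_def matrix_matrix_mult_def vec_to_mat_def sum_distrib_left mult.assoc)

lemma linear_trace_vec_to_mat:
  "Vector_Spaces.linear (*s) (*) (\<lambda>a. 1 / 2 * (trace (vec_to_mat a ** B) + trace (vec_to_mat a ** C)))"
  by unfold_locales
     (simp_all add: trace_vec_to_mat_add trace_vec_to_mat_scale algebra_simps add_divide_distrib)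

lemma peval_cubic_of_sM:
  fixes x :: "complex ^ ('n::finite \<times> 'n)"
  shows "peval (cubic_of sM) x = trace (vec_to_mat x ** vec_to_mat x ** vec_to_mat x)"
proof -
  have 1: "sM a b c = 1 / 2 * (trace (vec_to_mat a ** (vec_to_mat b ** vec_to_mat c))
      + trace (vec_to_mat a ** (vec_to_mat c ** vec_to_mat b)))" for a b c :: "complex ^ ('n \<times> 'n)"
    unfolding sM_def sM_mat_def
    by (metis matrix_mul_assoc trace_mul_sym)
  then have 2: "sM a b c = sM b a c" "sM a b c = sM c a b" for a b c :: "complex ^ ('n \<times> 'n)"
    by (metis (no_types, lifting) add.commute matrix_mul_assoc trace_mul_sym)+
  have lin: "Vector_Spaces.linear (*s) (*) (\<lambda>a. sM a b c)" for b c :: "complex ^ ('n \<times> 'n)"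
    unfolding 1 by (rule linear_trace_vec_to_mat)
  have "peval (cubic_of sM) x = sM x x x"
  proof (rule peval_cubic_of)
    fix a b :: "complex ^ ('n \<times> 'n)"
    show "Vector_Spaces.linear (*s) (*) (\<lambda>x. sM x a b)" by (rule lin)
    have "(\<lambda>x. sM a x b) = (\<lambda>x. sM x a b)" using 2(1) by blast
    then show "Vector_Spaces.linear (*s) (*) (\<lambda>x. sM a x b)" using lin by simp
    have "(\<lambda>x. sM a b x) = (\<lambda>x. sM x a b)" using 2(2) by blast
    then show "Vector_Spaces.linear (*s) (*) (\<lambda>x. sM a b x)" using lin by simp
  qed
  then show ?thesis by (simp add: sM_def sM_mat_def)
qed

end

theory Submission
  imports Defs "HOL-Computational_Algebra.Polynomial"
begin

text \<open>Write \<open>N = n + 1\<close>. The gradient of \<open>A \<mapsto> trace (A\<^sup>3)\<close> at \<open>A\<close> is three times the transpose of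
  \<open>A\<^sup>2\<close>, so the singular locus consists of the lines spanned by the nonzero matrices with
  \<open>A\<^sup>2 = 0\<close>. The claim is that this locus has dimension \<open>N\<^sup>2 div 2 - 1\<close>, to be subtracted from the
  dimension \<open>N\<^sup>2 - 1\<close> of the ambient space. For \<open>N = 1\<close> the locus is empty and the convention
  for the dimension of the empty space gives the same number.

  The geometry is elementary. If \<open>A\<^sup>2 = 0\<close>, the image \<open>V\<close> of \<open>A\<close> lies in its kernel. Choose
  \<open>J\<close> such that \<open>V\<close> is complementary to the coordinate space of \<open>J\<close>, that is, \<open>V\<close> is the graph
  of a matrix \<open>W\<close> with rows in \<open>J\<close> and columns in the complement of \<open>J\<close>. Then \<open>A\<close> is determined
  polynomially by \<open>W\<close> and by its block with rows outside and columns inside \<open>J\<close>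
  (\<open>square_zero_has_param\<close>). These are \<open>2 |J| (N - |J|) \<le> N\<^sup>2 div 2\<close> parameters, with equality when
  \<open>|J|\<close> is half of \<open>N\<close>, rounded either way; passing to lines removes one of them.

  Dimensions are computed from the definition by chains.

  Upper bound. Along a chain \<open>Z\<^sub>0 \<subset> \<dots> \<subset> Z\<^sub>k\<close> of irreducible closed sets, forms that vanish on one
  member but not on the next one have monomials which, once homogenized, are linearly independent on \<open>Z\<^sub>k\<close>, so that for some
  \<open>E\<close> and every \<open>m\<close> there are \<open>(m + 1)\<^sup>k\<close> independent forms of degree \<open>m E\<close>
  (\<open>chain_indep_forms\<close>). On the other hand, on a set covered by finitely many polynomial charts with
  \<open>D\<close> parameters, a form of degree \<open>d\<close> is known from its values at \<open>O(d\<^sup>D)\<close> points, namely the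
  images of a grid (\<open>charts_determine_forms\<close>). Comparing growth rates gives \<open>k \<le> D\<close>
  (\<open>chain_length_le\<close>).

  Lower bound. Closures of polynomially parametrized sets are irreducible, and letting the parameters
  vanish one after the other gives a chain. Its inclusions are strict as soon as each step is
  witnessed by a coordinate which vanishes on the smaller but not on the larger set
  (\<open>parametrized_chain\<close>). For square-zero matrices such witnesses exist if the parameters are dropped in a suitable order
  (\<open>square_zero_lines_chain\<close>).\<close>


section \<open>Forms as functions\<close>

text \<open>The dimension arguments need only values of homogeneous polynomials, along parametrizations and
  on chains of closed sets, so these polynomials are handled through the functions they define.\<close>

definition form :: "nat \<Rightarrow> (complex ^ 'i::finite \<Rightarrow> complex) \<Rightarrow> bool" where
  "form d g \<longleftrightarrow> (\<exists>f. homogeneous d f \<and> g = peval f)"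

lemma form_zero: "form d (\<lambda>x. 0)"
  unfolding form_def by (rule exI[of _ 0]) (auto simp: homogeneous_def)

lemma form_const: "form 0 (\<lambda>x. c)"
  unfolding form_def
  by (rule exI[of _ "pconst c"]) (auto simp: homogeneous_def pconst_def[of c] fun_eq_iff peval_single)

lemma form_coord: "form 1 (\<lambda>x. x $ i)"
  unfolding form_def
proof (intro exI conjI)
  have "(\<Sum>j\<in>UNIV. (1::nat) when i = j) = 1"
    by (simp add: when_def)
  then show "homogeneous 1 (pvar i)"
    by (simp add: homogeneous_def pvar_def lookup_single)
qed (simp add: fun_eq_iff)

lemma form_add:
  assumes "form d f" "form d g"
  shows "form d (\<lambda>x. f x + g x)"
proof -
  obtain f' g' where *: "homogeneous d f'" "f = peval f'" "homogeneous d g'" "g = peval g'"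
    using assms by (auto simp: form_def)
  have "homogeneous d (f' + g')"
    using * keys_add[of f' g'] unfolding homogeneous_def by blast
  then show ?thesis
    unfolding form_def using * by (intro exI[of _ "f' + g'"]) (simp add: peval_add fun_eq_iff)
qed

lemma form_mult:
  assumes "form d f" "form e g"
  shows "form (d + e) (\<lambda>x. f x * g x)"
  using assms unfolding form_def
  by (metis (no_types, lifting) homogeneous_mult peval_mult ext)

lemma form_cmult: "form d g \<Longrightarrow> form d (\<lambda>x. c * g x)"
  using form_mult[OF form_const[of c]] by fastforce

lemma form_sum: "(\<And>a. a \<in> A \<Longrightarrow> form d (g a)) \<Longrightarrow> form d (\<lambda>x. \<Sum>a\<in>A. g a x)"
  by (induction A rule: infinite_finite_induct) (auto intro: form_zero form_add)

lemma form_power: "form d g \<Longrightarrow> form (k * d) (\<lambda>x. g x ^ k)"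
  by (induction k) (auto intro: form_const form_mult)

lemma form_scale: "form d g \<Longrightarrow> g (c *s x) = c ^ d * g x"
  by (auto simp: form_def peval_scale)

lemma form_vanishes_on_line:
  assumes "form d g" "g x = 0" "y \<in> vec.span {x}"
  shows "g y = 0"
  using assms by (auto simp: vec.span_singleton form_scale)


section \<open>Polynomial functions of one variable and grids\<close>

definition upoly :: "nat \<Rightarrow> (complex \<Rightarrow> complex) \<Rightarrow> bool" where
  "upoly e h \<longleftrightarrow> (\<exists>q. degree q \<le> e \<and> h = poly q)"

lemma upoly_const: "upoly e (\<lambda>z. c)"
  unfolding upoly_def by (rule exI[of _ "[:c:]"]) (auto simp: fun_eq_iff)

lemma upoly_id: "0 < e \<Longrightarrow> upoly e (\<lambda>z. z)"
  unfolding upoly_def by (rule exI[of _ "[:0, 1:]"]) (auto simp: fun_eq_iff)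

lemma upoly_if: "upoly e f \<Longrightarrow> upoly e g \<Longrightarrow> upoly e (\<lambda>z. if c then f z else g z)"
  by (cases c) simp_all

lemma upoly_add: "upoly e f \<Longrightarrow> upoly e g \<Longrightarrow> upoly e (\<lambda>z. f z + g z)"
  unfolding upoly_def by (metis (no_types, lifting) degree_add_le ext poly_add)

lemma upoly_uminus: "upoly e f \<Longrightarrow> upoly e (\<lambda>z. - f z)"
  unfolding upoly_def by (metis (no_types, lifting) degree_minus ext poly_minus)

lemma upoly_mult: 
  assumes "upoly d f" "upoly e g" shows "upoly (d + e) (\<lambda>z. f z * g z)"
proof -
  obtain p q where "degree p \<le> d" "f = poly p" "degree q \<le> e" "g = poly q"
    using assms by (auto simp: upoly_def)
  then show ?thesis
    unfolding upoly_def
    by (intro exI[of _ "p * q"]) (auto simp: fun_eq_iff intro: degree_mult_le[THEN order_trans])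
qed

lemma upoly_sum: "(\<And>a. a \<in> A \<Longrightarrow> upoly e (f a)) \<Longrightarrow> upoly e (\<lambda>z. \<Sum>a\<in>A. f a z)"
  by (induction A rule: infinite_finite_induct) (auto intro: upoly_const upoly_add)

lemma upoly_power: "upoly e f \<Longrightarrow> upoly (e * k) (\<lambda>z. f z ^ k)"
  by (induction k) (auto intro: upoly_const upoly_mult)

lemma upoly_prod: "(\<And>a. a \<in> A \<Longrightarrow> upoly (e a) (f a)) \<Longrightarrow> upoly (\<Sum>a\<in>A. e a) (\<lambda>z. \<Prod>a\<in>A. f a z)"
  by (induction A rule: infinite_finite_induct) (auto intro: upoly_const upoly_mult)

lemma form_upoly:
  assumes "form d g" "\<And>i. upoly e (\<lambda>z. \<gamma> z $ i)"
  shows "upoly (e * d) (\<lambda>z. g (\<gamma> z))"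
proof -
  obtain f where f: "homogeneous d f" "g = peval f"
    using assms by (auto simp: form_def)
  have "upoly (e * d) (\<lambda>z. Poly_Mapping.lookup f m * (\<Prod>i\<in>UNIV. (\<gamma> z $ i) ^ Poly_Mapping.lookup m i))"
    if "m \<in> Poly_Mapping.keys f" for m
  proof -
    have "upoly (0 + (\<Sum>i\<in>UNIV. e * Poly_Mapping.lookup m i))
       (\<lambda>z. Poly_Mapping.lookup f m * (\<Prod>i\<in>UNIV. (\<gamma> z $ i) ^ Poly_Mapping.lookup m i))"
      by (intro upoly_mult upoly_const upoly_prod upoly_power assms)
    moreover have "(\<Sum>i\<in>UNIV. e * Poly_Mapping.lookup m i) = e * d"
      using f(1) that by (simp add: homogeneous_def flip: sum_distrib_left)
    ultimately show ?thesis by simp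
  qed
  then show ?thesis
    unfolding f(2) peval_def by (rule upoly_sum)
qed

lemma upoly_mult_eq_0:
  assumes "upoly d f" "upoly e g" "\<And>z. f z * g z = 0"
  shows "(\<forall>z. f z = 0) \<or> (\<forall>z. g z = 0)"
proof -
  obtain p q where pq: "f = poly p" "g = poly q"
    using assms by (auto simp: upoly_def)
  then have "poly (p * q) = poly 0"
    using assms(3) by (auto simp: fun_eq_iff)
  then have "p * q = 0"
    by (simp only: poly_eq_poly_eq_iff)
  then show ?thesis using pq by auto
qed

lemma upoly_eq_0:
  assumes "upoly e f" "\<And>j. j \<le> e \<Longrightarrow> f (of_nat j) = 0"
  shows "f z = 0"
proof -
  obtain p where p: "degree p \<le> e" "f = poly p"
    using assms by (auto simp: upoly_def)
  have "p = 0"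
  proof (rule ccontr)
    assume "p \<noteq> 0"
    have "Suc e = card (of_nat ` {..e} :: complex set)"
      by (subst card_image) (auto simp: inj_on_def)
    also have "\<dots> \<le> card {x. poly p x = 0}"
      using assms(2) p \<open>p \<noteq> 0\<close> by (intro card_mono poly_roots_finite) auto
    also have "\<dots> \<le> degree p"
      using \<open>p \<noteq> 0\<close> by (rule card_poly_roots_bound)
    finally show False using p by simp
  qed
  then show ?thesis using p by simp
qed

text \<open>Polynomial functions of several variables are only needed through their restrictions to the
  coordinate lines: a function which has degree at most \<open>e\<close> in each variable of \<open>U\<close> separately is
  determined by its values on a grid with \<open>e + 1\<close> points in each direction. The variables outside
  of \<open>U\<close> are kept at the values given by \<open>b\<close>.\<close>

definition determining_grid :: "nat \<Rightarrow> 'v set \<Rightarrow> ('v \<Rightarrow> complex) \<Rightarrow> ('v \<Rightarrow> complex) set \<Rightarrow> bool" where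
  "determining_grid e U b G \<longleftrightarrow> finite G \<and> card G \<le> (e + 1) ^ card U \<and>
    (\<forall>t\<in>G. \<forall>v. v \<notin> U \<longrightarrow> t v = b v) \<and>
    (\<forall>h t. (\<forall>t. \<forall>v\<in>U. upoly e (\<lambda>z. h (t(v := z)))) \<longrightarrow> (\<forall>t\<in>G. h t = 0) \<longrightarrow>
      (\<forall>v. v \<notin> U \<longrightarrow> t v = b v) \<longrightarrow> h t = 0)"

lemma determining_gridD:
  assumes "determining_grid e U b G" "\<forall>t. \<forall>v\<in>U. upoly e (\<lambda>z. h (t(v := z)))"
    "\<forall>t\<in>G. h t = 0" "\<forall>v. v \<notin> U \<longrightarrow> t v = b v"
  shows "h t = 0"
  using assms unfolding determining_grid_def by blast

text \<open>Induction on the number of variables: fixing one variable at each of \<open>e + 1\<close> values leaves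
  a grid in the others, and a polynomial of degree at most \<open>e\<close> with \<open>e + 1\<close> zeros vanishes.\<close>

lemma determining_grid_exists: "finite U \<Longrightarrow> \<exists>G. determining_grid e U b G"
proof (induction U arbitrary: b rule: finite_induct)
  case empty
  have "determining_grid e {} b {b}"
    by (simp add: determining_grid_def fun_eq_iff[symmetric])
  then show ?case ..
next
  case (insert v U)
  obtain G where G: "\<And>b. determining_grid e U b (G b)"
    using insert.IH by metis
  let ?G = "\<Union>j\<in>{..e}. G (b(v := of_nat j))"
  have "card ?G \<le> (\<Sum>j\<le>e. card (G (b(v := of_nat j))))"
    by (rule card_UN_le) simp
  also have "\<dots> \<le> (\<Sum>j\<le>e. (e + 1) ^ card U)"
    using G by (intro sum_mono) (simp add: determining_grid_def)
  finally have card: "card ?G \<le> (e + 1) ^ card (insert v U)"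
    using insert.hyps by simp
  have fin: "finite ?G"
    using G by (simp add: determining_grid_def)
  have agree: "t w = b w" if t: "t \<in> ?G" and w: "w \<notin> insert v U" for t w
  proof -
    obtain j where "t \<in> G (b(v := of_nat j))" using t by blast
    then have "t w = (b(v := of_nat j)) w"
      using G[of "b(v := of_nat j)"] w unfolding determining_grid_def by blast
    then show ?thesis using w by simp
  qed
  have det: "h t = 0"
    if h: "\<forall>t. \<forall>v\<in>insert v U. upoly e (\<lambda>z. h (t(v := z)))" "\<forall>t\<in>?G. h t = 0"
      and t: "\<forall>w. w \<notin> insert v U \<longrightarrow> t w = b w" for h t
  proof -
    have zero: "h (t(v := of_nat j)) = 0" if "j \<le> e" for j
    proof -
      have "\<forall>t. \<forall>v\<in>U. upoly e (\<lambda>z. h (t(v := z)))" using h(1) by blast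
      moreover have "\<forall>t\<in>G (b(v := of_nat j)). h t = 0" using h(2) that by blast
      moreover have "\<forall>w. w \<notin> U \<longrightarrow> (t(v := of_nat j)) w = (b(v := of_nat j)) w" using t by auto
      ultimately show ?thesis
        using G[of "b(v := of_nat j)"] unfolding determining_grid_def by blast
    qed
    have "upoly e (\<lambda>z. h (t(v := z)))" using h(1) by blast
    from upoly_eq_0[OF this zero, of "t v"] show ?thesis by simp
  qed
  have "determining_grid e (insert v U) b ?G"
    unfolding determining_grid_def
  proof (intro conjI)
    show "\<forall>h t. (\<forall>t. \<forall>v\<in>insert v U. upoly e (\<lambda>z. h (t(v := z)))) \<longrightarrow> (\<forall>t\<in>?G. h t = 0) \<longrightarrow>
      (\<forall>w. w \<notin> insert v U \<longrightarrow> t w = b w) \<longrightarrow> h t = 0"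
      using det by blast
    show "\<forall>t\<in>?G. \<forall>w. w \<notin> insert v U \<longrightarrow> t w = b w"
      using agree by blast
  qed (rule fin card)+
  then show ?case ..
qed


section \<open>Closed sets and irreducibility in the Zariski topology\<close>

definition zero_lines :: "(complex ^ 'i::finite \<Rightarrow> complex) set \<Rightarrow> (complex ^ 'i) set set" where
  "zero_lines F = {L \<in> proj_space. \<forall>g\<in>F. \<forall>x\<in>L. g x = 0}"

lemma proj_zeros_eq_zero_lines: "proj_zeros S = zero_lines (peval ` S)"
  by (simp add: zero_lines_def proj_zeros_def)

lemma openin_zariski:
  "openin zariski U \<longleftrightarrow>
     (\<exists>S. (\<forall>f\<in>S. \<exists>d. homogeneous d f) \<and> U = proj_space - proj_zeros S)"
  by (simp only: zariski_def topology_inverse'[OF istopology_zariski])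

lemma topspace_zariski: "topspace (zariski :: (complex ^ 'i::finite) set topology) = proj_space"
proof
  show "topspace (zariski :: (complex ^ 'i) set topology) \<subseteq> proj_space"
    unfolding topspace_def by (auto simp: openin_zariski)
  have "openin zariski (proj_space :: (complex ^ 'i) set set)"
    unfolding openin_zariski
  proof (intro exI[of _ "{pconst 1}"] conjI)
    show "\<forall>f\<in>{pconst 1 :: 'i cpoly}. \<exists>d. homogeneous d f"
      by (auto simp: homogeneous_def pconst_def intro!: exI[of _ 0])
    show "proj_space = proj_space - proj_zeros {pconst 1 :: 'i cpoly}"
      by (auto simp: proj_zeros_def proj_space_def intro: vec.span_zero)
  qed
  then show "(proj_space :: (complex ^ 'i) set set) \<subseteq> topspace zariski"
    by (rule openin_subset)
qed

lemma closedin_zariski: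
  "closedin zariski Z \<longleftrightarrow> (\<exists>F. (\<forall>g\<in>F. \<exists>d. form d g) \<and> Z = zero_lines F)"
proof
  assume "closedin zariski Z"
  then obtain S where S: "\<forall>f\<in>S. \<exists>d. homogeneous d f" "proj_space - Z = proj_space - proj_zeros S"
    and Z: "Z \<subseteq> proj_space"
    by (auto simp: closedin_def openin_zariski topspace_zariski)
  have "Z = proj_zeros S"
    using S(2) Z by (auto simp: proj_zeros_def)
  then have "Z = zero_lines (peval ` S)"
    by (simp add: proj_zeros_eq_zero_lines)
  moreover have "\<forall>g\<in>peval ` S. \<exists>d. form d g"
    using S(1) unfolding form_def by blast
  ultimately show "\<exists>F. (\<forall>g\<in>F. \<exists>d. form d g) \<and> Z = zero_lines F"
    by blast
next
  assume "\<exists>F. (\<forall>g\<in>F. \<exists>d. form d g) \<and> Z = zero_lines F"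
  then obtain F where F: "\<forall>g\<in>F. \<exists>d. form d g" "Z = zero_lines F" by blast
  let ?S = "{f. (\<exists>d. homogeneous d f) \<and> peval f \<in> F}"
  have "peval ` ?S = F"
    using F(1) by (force simp: form_def)
  then have "Z = proj_zeros ?S"
    by (simp only: F(2) proj_zeros_eq_zero_lines)
  then have "openin zariski (proj_space - Z)"
    unfolding openin_zariski by (intro exI[of _ ?S] conjI) (blast, simp only:)
  then show "closedin zariski Z"
    using F(2) by (auto simp: closedin_def topspace_zariski zero_lines_def)
qed

lemma closedin_zero_lines: "(\<And>g. g \<in> F \<Longrightarrow> \<exists>d. form d g) \<Longrightarrow> closedin zariski (zero_lines F)"
  unfolding closedin_zariski by blast

lemma closed_separating_form:
  assumes "closedin zariski Z" "L \<in> proj_space" "L \<notin> Z"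
  obtains d f where "form d f" "\<And>x. x \<in> \<Union>Z \<Longrightarrow> f x = 0" "\<exists>x\<in>L. f x \<noteq> 0"
  using assms unfolding closedin_zariski zero_lines_def by blast

text \<open>The vanishing ideal of an irreducible set is prime, as the zero sets of the two factors
  would otherwise split it.\<close>

lemma irreducible_closed_prime:
  assumes Z: "irreducible_closed zariski Z" and "form d f" "form e g"
    and 0: "\<And>x. x \<in> \<Union>Z \<Longrightarrow> f x * g x = 0"
  shows "(\<forall>x\<in>\<Union>Z. f x = 0) \<or> (\<forall>x\<in>\<Union>Z. g x = 0)"
proof -
  let ?A = "Z \<inter> zero_lines {f}" and ?B = "Z \<inter> zero_lines {g}"
  have Zc: "closedin zariski Z"
    using Z by (simp add: irreducible_closed_def)
  then have sub: "Z \<subseteq> proj_space"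
    using closedin_subset topspace_zariski by blast
  have "closedin zariski ?A" "closedin zariski ?B"
    using assms by (auto intro!: closedin_Int closedin_zero_lines Zc)
  moreover have "Z = ?A \<union> ?B"
  proof -
    have "L \<in> zero_lines {f} \<or> L \<in> zero_lines {g}" if L: "L \<in> Z" for L
    proof -
      obtain x where x: "L = vec.span {x}"
        using L sub by (auto simp: proj_space_def)
      then have "x \<in> L" by (simp add: vec.span_base)
      then have "f x = 0 \<or> g x = 0" using 0 L by fastforce
      then show ?thesis
        using form_vanishes_on_line assms(2,3) L sub x unfolding zero_lines_def by blast
    qed
    then show ?thesis by blast
  qed
  ultimately have "Z = ?A \<or> Z = ?B"
    using Z unfolding irreducible_closed_def by blast
  then show ?thesis
    unfolding zero_lines_def by blast
qed

text \<open>For a set of nonzero vectors this is the Zariski closure of the set of lines they span.\<close>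

definition line_closure :: "(complex ^ 'i::finite) set \<Rightarrow> (complex ^ 'i) set set" where
  "line_closure S = zero_lines {g. (\<exists>d. form d g) \<and> (\<forall>x\<in>S. g x = 0)}"

lemma line_closure_mono: "S \<subseteq> S' \<Longrightarrow> line_closure S \<subseteq> line_closure S'"
  unfolding line_closure_def zero_lines_def by blast

lemma closedin_line_closure: "closedin zariski (line_closure S)"
  unfolding line_closure_def by (rule closedin_zero_lines) blast

lemma span_in_line_closure: "x \<in> S \<Longrightarrow> x \<noteq> 0 \<Longrightarrow> vec.span {x} \<in> line_closure S"
  unfolding line_closure_def zero_lines_def proj_space_def
  using form_vanishes_on_line by blast

lemma line_closure_subset:
  assumes "closedin zariski X" "S \<subseteq> \<Union>X"
  shows "line_closure S \<subseteq> X"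
proof
  fix L assume L: "L \<in> line_closure S"
  show "L \<in> X"
  proof (rule ccontr)
    assume "L \<notin> X"
    moreover have "L \<in> proj_space"
      using L by (simp add: line_closure_def zero_lines_def)
    ultimately obtain d f where "form d f" "\<And>x. x \<in> \<Union>X \<Longrightarrow> f x = 0" "\<exists>x\<in>L. f x \<noteq> 0"
      using closed_separating_form assms(1) by blast
    then show False
      using L assms(2) unfolding line_closure_def zero_lines_def by blast
  qed
qed

text \<open>Two proper closed subsets that cover the closure would be separated from \<open>S\<close> by forms
  whose product vanishes on \<open>S\<close>.\<close>

lemma irreducible_line_closure:
  assumes "S \<noteq> {}" "0 \<notin> S"
    and prime: "\<And>d e f g. form d f \<Longrightarrow> form e g \<Longrightarrow> \<forall>x\<in>S. f x * g x = 0 \<Longrightarrow>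
      (\<forall>x\<in>S. f x = 0) \<or> (\<forall>x\<in>S. g x = 0)"
  shows "irreducible_closed zariski (line_closure S)"
  unfolding irreducible_closed_def
proof (intro conjI allI impI)
  show "closedin zariski (line_closure S)" by (rule closedin_line_closure)
  show "line_closure S \<noteq> {}"
    using assms(1,2) span_in_line_closure by fastforce
next
  fix A B assume AB: "closedin zariski A \<and> closedin zariski B \<and> line_closure S = A \<union> B"
  show "line_closure S = A \<or> line_closure S = B"
  proof (rule ccontr)
    assume "\<not> ?thesis"
    then have "\<not> S \<subseteq> \<Union>A" "\<not> S \<subseteq> \<Union>B"
      using line_closure_subset AB by blast+
    then obtain x y where xy: "x \<in> S" "x \<notin> \<Union>A" "y \<in> S" "y \<notin> \<Union>B"
      by blast
    have sep: "\<exists>d f. form d f \<and> (\<forall>u\<in>\<Union>C. f u = 0) \<and> f x \<noteq> 0"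
      if C: "closedin zariski C" "x \<in> S" "x \<notin> \<Union>C" for C x
    proof -
      have "vec.span {x} \<notin> C" using C vec.span_base by blast
      moreover have "vec.span {x} \<in> proj_space"
        using C assms(2) by (auto simp: proj_space_def)
      ultimately obtain d f where "form d f" "\<And>u. u \<in> \<Union>C \<Longrightarrow> f u = 0" "\<exists>y\<in>vec.span {x}. f y \<noteq> 0"
        using closed_separating_form C(1) by blast
      then show ?thesis using form_vanishes_on_line by blast
    qed
    obtain d f where f: "form d f" "\<forall>u\<in>\<Union>A. f u = 0" "f x \<noteq> 0"
      using sep[of A x] AB xy(1,2) by metis
    obtain e g where g: "form e g" "\<forall>u\<in>\<Union>B. g u = 0" "g y \<noteq> 0"
      using sep[of B y] AB xy(3,4) by metis
    have "f u * g u = 0" if "u \<in> S" for u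
    proof -
      have "vec.span {u} \<in> A \<union> B"
        using span_in_line_closure[OF that] AB that assms(2) by auto
      then have "u \<in> \<Union>A \<or> u \<in> \<Union>B" using vec.span_base[of u "{u}"] by blast
      then show ?thesis using f g by auto
    qed
    then have "(\<forall>x\<in>S. f x = 0) \<or> (\<forall>x\<in>S. g x = 0)"
      by (intro prime[OF f(1) g(1)]) blast
    then show False
      using f(3) g(3) xy(1,3) by blast
  qed
qed

lemma irreducible_closed_subtopology:
  assumes "closedin T X"
  shows "irreducible_closed (subtopology T X) Z \<longleftrightarrow> irreducible_closed T Z \<and> Z \<subseteq> X"
  unfolding irreducible_closed_def closedin_closed_subtopology[OF assms] by blast


section \<open>Upper bounds for the Krull dimension\<close>

text \<open>A homogeneous linear system with fewer equations (the points of \<open>G\<close>) than unknowns has a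
  nontrivial solution, by elimination of one unknown per equation.\<close>

lemma nontrivial_solution:
  fixes g :: "'a \<Rightarrow> 'b \<Rightarrow> 'c::field"
  assumes "finite G" "finite A" "card G < card A"
  shows "\<exists>c. (\<exists>a\<in>A. c a \<noteq> 0) \<and> (\<forall>x\<in>G. (\<Sum>a\<in>A. c a * g a x) = 0)"
  using assms
proof (induction G arbitrary: A g rule: finite_induct)
  case empty
  then have "A \<noteq> {}" by auto
  then show ?case by (intro exI[of _ "\<lambda>_. 1"]) auto
next
  case (insert x G)
  show ?case
  proof (cases "\<forall>a\<in>A. g a x = 0")
    case True
    obtain c where "\<exists>a\<in>A. c a \<noteq> 0" "\<forall>x\<in>G. (\<Sum>a\<in>A. c a * g a x) = 0"
      using insert.IH[of A g] insert.prems insert.hyps by auto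
    then show ?thesis using True by (intro exI[of _ c]) auto
  next
    case False
    then obtain a0 where a0: "a0 \<in> A" "g a0 x \<noteq> 0" by blast
    let ?A = "A - {a0}"
    let ?g = "\<lambda>a y. g a y - g a x / g a0 x * g a0 y"
    have "finite ?A" "card G < card ?A"
      using insert.prems insert.hyps a0 by auto
    from insert.IH[OF this, of ?g] obtain c
      where c: "\<exists>a\<in>?A. c a \<noteq> 0" "\<forall>y\<in>G. (\<Sum>a\<in>?A. c a * ?g a y) = 0"
      by blast
    \<comment> \<open>The coefficient at \<open>a0\<close> is forced by the equation at \<open>x\<close>.\<close>
    define c' where "c' = c(a0 := - (\<Sum>a\<in>?A. c a * (g a x / g a0 x)))"
    have *: "(\<Sum>a\<in>A. c' a * g a y) = (\<Sum>a\<in>?A. c a * ?g a y)" for y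
    proof -
      have "(\<Sum>a\<in>A. c' a * g a y) = c' a0 * g a0 y + (\<Sum>a\<in>?A. c' a * g a y)"
        using insert.prems a0 by (intro sum.remove) auto
      also have "(\<Sum>a\<in>?A. c' a * g a y) = (\<Sum>a\<in>?A. c a * g a y)"
        by (rule sum.cong) (auto simp: c'_def)
      finally show ?thesis
        by (simp add: c'_def sum_distrib_right sum_subtractf right_diff_distrib mult.assoc)
    qed
    have "(\<Sum>a\<in>?A. c a * ?g a x) = 0"
      using a0 by (intro sum.neutral) auto
    moreover have "\<exists>a\<in>A. c' a \<noteq> 0"
      using c(1) by (auto simp: c'_def)
    ultimately show ?thesis
      using c(2) * by (intro exI[of _ c']) auto
  qed
qed

definition indep_forms ::
  "(complex ^ 'i::finite) set \<Rightarrow> nat \<Rightarrow> 'a set \<Rightarrow> ('a \<Rightarrow> complex ^ 'i \<Rightarrow> complex) \<Rightarrow> bool" where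
  "indep_forms S d A g \<longleftrightarrow> finite A \<and> (\<forall>a\<in>A. form d (g a)) \<and>
     (\<forall>c. (\<forall>x\<in>S. (\<Sum>a\<in>A. c a * g a x) = 0) \<longrightarrow> (\<forall>a\<in>A. c a = 0))"

lemma indep_formsD:
  assumes "indep_forms S d A g" "\<forall>x\<in>S. (\<Sum>a\<in>A. c a * g a x) = 0" "a \<in> A"
  shows "c a = 0"
  using assms unfolding indep_forms_def by blast

definition determines_forms :: "(complex ^ 'i::finite) set \<Rightarrow> nat \<Rightarrow> (complex ^ 'i) set \<Rightarrow> bool" where
  "determines_forms G d S \<longleftrightarrow> (\<forall>f. form d f \<longrightarrow> (\<forall>x\<in>G. f x = 0) \<longrightarrow> (\<forall>x\<in>S. f x = 0))"

lemma card_indep_forms_le: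
  assumes A: "indep_forms S d A g" and G: "finite G" "determines_forms G d S"
  shows "card A \<le> card G"
proof (rule ccontr)
  assume "\<not> ?thesis"
  then obtain c where c: "\<exists>a\<in>A. c a \<noteq> 0" "\<forall>x\<in>G. (\<Sum>a\<in>A. c a * g a x) = 0"
    using nontrivial_solution[of G A g] A G by (auto simp: indep_forms_def)
  have "form d (\<lambda>x. \<Sum>a\<in>A. c a * g a x)"
    using A by (intro form_sum form_cmult) (simp add: indep_forms_def)
  then have "\<forall>x\<in>S. (\<Sum>a\<in>A. c a * g a x) = 0"
    using G(2) c(2) unfolding determines_forms_def by blast
  then show False
    using A c(1) unfolding indep_forms_def by blast
qed

lemma cancel_form_power:
  assumes Y: "irreducible_closed zariski Y"
    and f: "form e f" "\<exists>x\<in>\<Union>Y. f x \<noteq> 0" and h: "form d h" "\<forall>x\<in>\<Union>Y. f x ^ k * h x = 0"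
  shows "\<forall>x\<in>\<Union>Y. h x = 0"
  using irreducible_closed_prime[OF Y form_power[OF f(1), of k] h(1)] h(2) f(2) by fastforce

text \<open>This is where a chain of irreducible sets produces many independent forms. Each strict inclusion
  \<open>Z \<subset> Y\<close> provides a form \<open>f\<close> which vanishes on \<open>Z\<close> but not on \<open>Y\<close>, and its powers, homogenized by a form
  \<open>l\<close>, multiply the number of independent forms by \<open>m + 1\<close>: in a linear relation, let \<open>i\<close> be the
  lowest power of \<open>f\<close> that occurs. It can be cancelled since \<open>Y\<close> is irreducible, and restriction of
  what remains to \<open>Z\<close> leaves a relation between the given forms on \<open>Z\<close>.\<close>

lemma indep_forms_step:
  assumes Y: "irreducible_closed zariski Y"
    and Z: "irreducible_closed zariski Z" "Z \<subseteq> Y"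
    and f: "form e f" "\<exists>x\<in>\<Union>Y. f x \<noteq> 0" "\<forall>x\<in>\<Union>Z. f x = 0"
    and l: "form e l" "\<exists>x\<in>\<Union>Z. l x \<noteq> 0"
    and A: "indep_forms (\<Union>Z) d A g"
  shows "indep_forms (\<Union>Y) (m * e + d) ({..m} \<times> A) (\<lambda>(j, a) x. f x ^ j * l x ^ (m - j) * g a x)"
  unfolding indep_forms_def
proof (intro conjI ballI allI impI)
  have fin: "finite A" and gf: "\<And>a. a \<in> A \<Longrightarrow> form d (g a)"
    and ind: "\<And>c a. (\<forall>x\<in>\<Union>Z. (\<Sum>a\<in>A. c a * g a x) = 0) \<Longrightarrow> a \<in> A \<Longrightarrow> c a = 0"
    using A unfolding indep_forms_def by blast+
  show "finite ({..m} \<times> A)" using fin by simp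
  have form_jl: "form ((m - i) * e + d) (\<lambda>x. f x ^ (j - i) * l x ^ (m - j) * h x)"
    if "i \<le> j" "j \<le> m" "form d h" for i j h
  proof -
    have "form ((j - i) * e + (m - j) * e + d) (\<lambda>x. f x ^ (j - i) * l x ^ (m - j) * h x)"
      using that by (intro form_mult form_power f l)
    moreover have "(j - i) * e + (m - j) * e = (m - i) * e"
      using that by (simp flip: add_mult_distrib)
    ultimately show ?thesis by simp
  qed
  show "form (m * e + d) ((case p of (j, a) \<Rightarrow> \<lambda>x. f x ^ j * l x ^ (m - j) * g a x))"
    if "p \<in> {..m} \<times> A" for p
    using that form_jl[of 0] gf by (cases p) auto
  fix c :: "nat \<times> _ \<Rightarrow> complex" and p
  assume c: "\<forall>x\<in>\<Union>Y. (\<Sum>p\<in>{..m} \<times> A. c p * (case p of (j, a) \<Rightarrow> \<lambda>x. f x ^ j * l x ^ (m - j) * g a x) x) = 0"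
    and p: "p \<in> {..m} \<times> A"
  define G where "G j x = (\<Sum>a\<in>A. c (j, a) * g a x)" for j x
  have Gform: "form d (G j)" for j
    unfolding G_def by (intro form_sum form_cmult gf)
  have rel: "(\<Sum>j\<le>m. f x ^ j * l x ^ (m - j) * G j x) = 0" if "x \<in> \<Union>Y" for x
  proof -
    have "(\<Sum>p\<in>{..m} \<times> A. c p * (case p of (j, a) \<Rightarrow> \<lambda>x. f x ^ j * l x ^ (m - j) * g a x) x)
        = (\<Sum>j\<le>m. \<Sum>a\<in>A. c (j, a) * (f x ^ j * l x ^ (m - j) * g a x))"
      by (simp add: sum.cartesian_product case_prod_unfold)
    also have "\<dots> = (\<Sum>j\<le>m. f x ^ j * l x ^ (m - j) * G j x)"
      by (simp add: G_def sum_distrib_left mult_ac)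
    finally have eq: "(\<Sum>p\<in>{..m} \<times> A. c p * (case p of (j, a) \<Rightarrow> \<lambda>x. f x ^ j * l x ^ (m - j) * g a x) x)
        = (\<Sum>j\<le>m. f x ^ j * l x ^ (m - j) * G j x)" .
    show ?thesis using bspec[OF c that] unfolding eq .
  qed
  have "\<forall>a\<in>A. c (j, a) = 0" if "j \<le> m" for j
    using that
  proof (induction j rule: less_induct)
    case (less i)
    \<comment> \<open>The relation is \<open>f\<^sup>i ?h = 0\<close> on \<open>Y\<close>, and \<open>?h\<close> reduces on \<open>Z\<close> to its first term.\<close>
    let ?h = "\<lambda>x. \<Sum>j=i..m. f x ^ (j - i) * l x ^ (m - j) * G j x"
    have "f x ^ i * ?h x = 0" if x: "x \<in> \<Union>Y" for x
    proof -
      have "f x ^ i * ?h x = (\<Sum>j=i..m. f x ^ j * l x ^ (m - j) * G j x)"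
        by (simp add: sum_distrib_left flip: mult.assoc power_add)
      also have "\<dots> = (\<Sum>j\<le>m. f x ^ j * l x ^ (m - j) * G j x)"
        by (rule sum.mono_neutral_left) (use less in \<open>auto simp: G_def not_le\<close>)
      finally show ?thesis using rel[OF x] by simp
    qed
    moreover have "form ((m - i) * e + d) ?h"
      by (intro form_sum form_jl Gform) auto
    ultimately have h0: "\<forall>x\<in>\<Union>Y. ?h x = 0"
      using cancel_form_power[OF Y f(1,2)] by blast
    have "l x ^ (m - i) * G i x = 0" if x: "x \<in> \<Union>Z" for x
    proof -
      have "?h x = (\<Sum>j\<in>{i}. f x ^ (j - i) * l x ^ (m - j) * G j x)"
        by (rule sum.mono_neutral_right) (use less f(3) x in auto)
      moreover have "?h x = 0" using h0 x Z(2) by blast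
      ultimately show ?thesis by simp
    qed
    then have "\<forall>x\<in>\<Union>Z. G i x = 0"
      using cancel_form_power[OF Z(1) l Gform] by blast
    then show ?case
      using ind[of "\<lambda>a. c (i, a)"] unfolding G_def by blast
  qed
  then show "c p = 0" using p by auto
qed

lemma indep_forms_reindex:
  assumes "indep_forms S d A g" "bij_betw \<phi> B A"
  shows "indep_forms S d B (\<lambda>b. g (\<phi> b))"
  unfolding indep_forms_def
proof (intro conjI ballI allI impI)
  show "finite B" using assms bij_betw_finite by (auto simp: indep_forms_def)
  show "form d (g (\<phi> b))" if "b \<in> B" for b
    using assms that bij_betwE unfolding indep_forms_def by blast
  fix c b assume c: "\<forall>x\<in>S. (\<Sum>b\<in>B. c b * g (\<phi> b) x) = 0" and b: "b \<in> B"
  let ?c = "\<lambda>a. c (inv_into B \<phi> a)"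
  have inv: "inv_into B \<phi> (\<phi> b) = b" if "b \<in> B" for b
    using that assms(2) by (simp add: bij_betw_def)
  have "(\<Sum>a\<in>A. ?c a * g a x) = (\<Sum>b\<in>B. c b * g (\<phi> b) x)" for x
  proof -
    have "(\<Sum>a\<in>A. ?c a * g a x) = (\<Sum>b\<in>B. ?c (\<phi> b) * g (\<phi> b) x)"
      by (rule sum.reindex_bij_betw[OF assms(2), symmetric])
    then show ?thesis using inv by simp
  qed
  then have "\<forall>x\<in>S. (\<Sum>a\<in>A. ?c a * g a x) = 0" using c by simp
  then have "\<forall>a\<in>A. ?c a = 0" using indep_formsD[OF assms(1), of ?c] by blast
  then show "c b = 0" using inv[OF b] b bij_betwE[OF assms(2)] by metis
qed

lemma irreducible_closed_subset_proj_space: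
  "irreducible_closed zariski Z \<Longrightarrow> Z \<subseteq> proj_space"
  unfolding irreducible_closed_def topspace_zariski[symmetric] by (simp add: closedin_subset)

lemma irreducible_closed_nonvanishing_form:
  assumes "irreducible_closed zariski Z"
  shows "\<exists>l. form e l \<and> (\<exists>x\<in>\<Union>Z. l x \<noteq> 0)"
proof -
  obtain L where L: "L \<in> Z" using assms by (auto simp: irreducible_closed_def)
  then obtain x where x: "L = vec.span {x}" "x \<noteq> 0"
    using irreducible_closed_subset_proj_space[OF assms] by (auto simp: proj_space_def)
  then obtain i where i: "x $ i \<noteq> 0" by (auto simp: vec_eq_iff)
  have "form (e * 1) (\<lambda>x. (x $ i) ^ e)" by (intro form_power form_coord)
  moreover have "x \<in> \<Union>Z" using L x vec.span_base by blast
  ultimately show ?thesis using i by (intro exI[of _ "\<lambda>x. (x $ i) ^ e"]) auto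
qed

lemma chain_indep_forms:
  assumes "\<And>j. j \<le> k \<Longrightarrow> irreducible_closed zariski (Z j)" "\<And>j. j < k \<Longrightarrow> Z j \<subset> Z (Suc j)"
  shows "\<exists>E. \<forall>m. \<exists>g. indep_forms (\<Union>(Z k)) (m * E) {..<(m + 1) ^ k} g"
  using assms
proof (induction k)
  case 0
  obtain l where l: "form 0 l" "\<exists>x\<in>\<Union>(Z 0). l x \<noteq> 0"
    using irreducible_closed_nonvanishing_form 0(1)[of 0] by blast
  have "indep_forms (\<Union>(Z 0)) (m * 0) {..<(m + 1) ^ 0} (\<lambda>_. l)" for m
    unfolding indep_forms_def using l by auto
  then show ?case by (intro exI[of _ 0] allI) (rule exI)
next
  case (Suc k)
  obtain E where E: "\<And>m. \<exists>g. indep_forms (\<Union>(Z k)) (m * E) {..<(m + 1) ^ k} g"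
    using Suc.IH Suc.prems by (metis le_SucI less_SucI)
  have Zk: "irreducible_closed zariski (Z k)" and Y: "irreducible_closed zariski (Z (Suc k))"
    using Suc.prems(1) by auto
  have sub: "Z k \<subset> Z (Suc k)" using Suc.prems(2) by simp
  then obtain L where L: "L \<in> Z (Suc k)" "L \<notin> Z k" by blast
  obtain e f where f: "form e f" "\<And>x. x \<in> \<Union>(Z k) \<Longrightarrow> f x = 0" "\<exists>x\<in>L. f x \<noteq> 0"
    using closed_separating_form[of "Z k" L] Zk L irreducible_closed_subset_proj_space[OF Y]
    unfolding irreducible_closed_def by (metis subsetD)
  obtain l where l: "form e l" "\<exists>x\<in>\<Union>(Z k). l x \<noteq> 0"
    using irreducible_closed_nonvanishing_form[OF Zk] by blast
  have "\<exists>g. indep_forms (\<Union>(Z (Suc k))) (m * (e + E)) {..<(m + 1) ^ Suc k} g" for m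
  proof -
    obtain g where g: "indep_forms (\<Union>(Z k)) (m * E) {..<(m + 1) ^ k} g"
      using E by blast
    have "\<exists>g. indep_forms (\<Union>(Z (Suc k))) (m * e + m * E) ({..m} \<times> {..<(m + 1) ^ k}) g"
      using indep_forms_step[OF Y Zk _ f(1) _ _ l g] sub L f by blast
    moreover have "card {..<(m + 1) ^ Suc k} = card ({..m} \<times> {..<(m + 1) ^ k})"
      by (simp add: card_cartesian_product)
    then obtain \<phi> where "bij_betw \<phi> {..<(m + 1) ^ Suc k} ({..m} \<times> {..<(m + 1) ^ k})"
      using finite_same_card_bij[of "{..<(m + 1) ^ Suc k}" "{..m} \<times> {..<(m + 1) ^ k}"] by blast
    ultimately show ?thesis
      using indep_forms_reindex by (fastforce simp: distrib_left)
  qed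
  then show ?case by (intro exI[of _ "e + E"] allI)
qed

text \<open>If \<open>k > D\<close>, the number \<open>(m + 1)\<^sup>k\<close> of independent forms of degree \<open>m E\<close> would outgrow the
  number of points, which is at most of order \<open>m\<^sup>D\<close>.\<close>

lemma chain_length_le:
  assumes "\<And>j. j \<le> k \<Longrightarrow> irreducible_closed zariski (Z j)" "\<And>j. j < k \<Longrightarrow> Z j \<subset> Z (Suc j)"
    and "Z k \<subseteq> X"
    and G: "\<And>d. \<exists>G. finite G \<and> card G \<le> C * (e * d + 1) ^ D \<and> determines_forms G d (\<Union>X)"
  shows "k \<le> D"
proof (rule ccontr)
  assume "\<not> k \<le> D"
  obtain E where E: "\<And>m. \<exists>g. indep_forms (\<Union>(Z k)) (m * E) {..<(m + 1) ^ k} g"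
    using chain_indep_forms[of k Z] assms(1,2) by blast
  have bound: "(m + 1) ^ k \<le> C * (e * (m * E) + 1) ^ D" for m
  proof -
    obtain g where "indep_forms (\<Union>(Z k)) (m * E) {..<(m + 1) ^ k} g" using E by blast
    moreover obtain G where G': "finite G" "card G \<le> C * (e * (m * E) + 1) ^ D"
      "determines_forms G (m * E) (\<Union>X)" using G by blast
    moreover have "determines_forms G (m * E) (\<Union>(Z k))"
      using G'(3) assms(3) unfolding determines_forms_def by blast
    ultimately show ?thesis
      using card_indep_forms_le by (fastforce dest: order_trans)
  qed
  \<comment> \<open>With this value the bound weakens to \<open>(m + 1)\<^sup>k \<le> m (m + 1)\<^sup>D\<close>.\<close>
  define m where "m = C * (e * E + 1) ^ D"
  have "(m + 1) * (m + 1) ^ D \<le> (m + 1) ^ k"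
    using \<open>\<not> k \<le> D\<close> power_increasing[of "Suc D" k "m + 1"] by simp
  also have "\<dots> \<le> C * (e * (m * E) + 1) ^ D" by (rule bound)
  also have "\<dots> \<le> C * ((e * E + 1) * (m + 1)) ^ D"
    by (intro mult_left_mono power_mono) (auto simp: algebra_simps)
  also have "\<dots> = m * (m + 1) ^ D"
    by (simp only: power_mult_distrib mult.assoc[symmetric] m_def[symmetric])
  finally show False by simp
qed

text \<open>Substitution of a chart turns a form of degree \<open>d\<close> into a polynomial of degree at most
  \<open>e d\<close> in each parameter, so its values on the image of a grid decide whether it vanishes.
  Each chart has free parameters \<open>U c\<close>; the others have the fixed values \<open>b c\<close>.\<close>

lemma charts_determine_forms:
  fixes p :: "'c \<Rightarrow> ('v \<Rightarrow> complex) \<Rightarrow> complex ^ 'i::finite"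
  assumes "finite Cs" and U: "\<And>c. c \<in> Cs \<Longrightarrow> finite (U c) \<and> card (U c) \<le> D"
    and p: "\<And>c t v i. upoly e (\<lambda>z. p c (t(v := z)) $ i)"
    and cover: "\<And>L. L \<in> X \<Longrightarrow> \<exists>c\<in>Cs. \<exists>t. (\<forall>v. v \<notin> U c \<longrightarrow> t v = b c v) \<and> L \<subseteq> vec.span {p c t}"
  shows "\<exists>G. finite G \<and> card G \<le> card Cs * (e * d + 1) ^ D \<and> determines_forms G d (\<Union>X)"
proof -
  have "\<forall>c\<in>Cs. \<exists>G. determining_grid (e * d) (U c) (b c) G"
    using U determining_grid_exists by blast
  then obtain G where G: "\<And>c. c \<in> Cs \<Longrightarrow> determining_grid (e * d) (U c) (b c) (G c)"
    by metis
  let ?G = "\<Union>c\<in>Cs. p c ` G c"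
  have finG: "finite (G c)" if "c \<in> Cs" for c
    using G[OF that] by (simp add: determining_grid_def)
  have "card ?G \<le> (\<Sum>c\<in>Cs. card (p c ` G c))"
    using assms(1) by (rule card_UN_le)
  also have "\<dots> \<le> (\<Sum>c\<in>Cs. (e * d + 1) ^ D)"
  proof (rule sum_mono)
    fix c assume c: "c \<in> Cs"
    have "card (p c ` G c) \<le> card (G c)" using finG[OF c] by (rule card_image_le)
    also have "\<dots> \<le> (e * d + 1) ^ card (U c)"
      using G[OF c] by (simp add: determining_grid_def)
    also have "\<dots> \<le> (e * d + 1) ^ D"
      using U[OF c] by (intro power_increasing) auto
    finally show "card (p c ` G c) \<le> (e * d + 1) ^ D" .
  qed
  finally have "card ?G \<le> card Cs * (e * d + 1) ^ D" by simp
  moreover have "finite ?G" using assms(1) finG by auto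
  moreover have "determines_forms ?G d (\<Union>X)"
    unfolding determines_forms_def
  proof (intro allI impI ballI)
    fix f x assume f: "form d f" "\<forall>x\<in>?G. f x = 0" and "x \<in> \<Union>X"
    then obtain L where L: "L \<in> X" "x \<in> L" by blast
    obtain c t where c: "c \<in> Cs" and t: "\<forall>v. v \<notin> U c \<longrightarrow> t v = b c v" and sub: "L \<subseteq> vec.span {p c t}"
      using cover[OF L(1)] by blast
    have up: "\<forall>t. \<forall>v\<in>U c. upoly (e * d) (\<lambda>z. f (p c (t(v := z))))"
      by (intro allI ballI form_upoly[OF f(1)] p)
    have zero: "\<forall>t\<in>G c. f (p c t) = 0"
      using f(2) c by blast
    have "f (p c t) = 0"
      using determining_gridD[OF G[OF c] up zero t] .
    then show "f x = 0"
      using form_vanishes_on_line[OF f(1)] L(2) sub by blast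
  qed
  ultimately show ?thesis by blast
qed


section \<open>Chains of parametrized subvarieties\<close>

text \<open>Any two parameter values in a coordinate subspace are joined by a line in that subspace. If two
  forms do not vanish at the respective ends, their product cannot vanish along the image of this line.
  Zero is no point of projective space and has to be removed from the image; multiplication by a
  coordinate that is nonzero at one end makes up for the points of the line where the image is zero.\<close>

lemma parametrized_prime:
  fixes p :: "('v \<Rightarrow> complex) \<Rightarrow> complex ^ 'i::finite"
  assumes curve: "\<And>t t' i. upoly e (\<lambda>z. p (\<lambda>v. (1 - z) * t v + z * t' v) $ i)"
    and fg: "form d f" "form d' g" "\<forall>x\<in>p ` {t. {v. t v \<noteq> 0} \<subseteq> W} - {0}. f x * g x = 0"
  shows "(\<forall>x\<in>p ` {t. {v. t v \<noteq> 0} \<subseteq> W} - {0}. f x = 0) \<or>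
    (\<forall>x\<in>p ` {t. {v. t v \<noteq> 0} \<subseteq> W} - {0}. g x = 0)"
proof (rule ccontr)
  assume "\<not> ?thesis"
  then obtain t t' where t: "{v. t v \<noteq> 0} \<subseteq> W" "p t \<noteq> 0" "f (p t) \<noteq> 0"
    and t': "{v. t' v \<noteq> 0} \<subseteq> W" "g (p t') \<noteq> 0" by blast
  obtain i where i: "p t $ i \<noteq> 0" using t(2) by (auto simp: vec_eq_iff)
  define \<gamma> where "\<gamma> z = p (\<lambda>v. (1 - z) * t v + z * t' v)" for z
  have \<gamma>: "\<gamma> 0 = p t" "\<gamma> 1 = p t'" by (simp_all add: \<gamma>_def)
  have up: "upoly (e * k) (\<lambda>z. h (\<gamma> z))" if "form k h" for k h
    using curve by (intro form_upoly[OF that]) (simp add: \<gamma>_def)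
  have "(f (\<gamma> z) * \<gamma> z $ i) * g (\<gamma> z) = 0" for z
  proof (cases "\<gamma> z = 0")
    case False
    have "{v. (1 - z) * t v + z * t' v \<noteq> 0} \<subseteq> W"
    proof
      fix v assume "v \<in> {v. (1 - z) * t v + z * t' v \<noteq> 0}"
      then have "t v \<noteq> 0 \<or> t' v \<noteq> 0" by auto
      then show "v \<in> W" using t(1) t'(1) by blast
    qed
    then have "\<gamma> z \<in> p ` {t. {v. t v \<noteq> 0} \<subseteq> W} - {0}"
      unfolding \<gamma>_def using False by (auto simp: \<gamma>_def)
    then show ?thesis using fg(3) by auto
  qed auto
  with upoly_mult_eq_0[OF upoly_mult[OF up[OF fg(1)] up[OF form_coord[of i]]] up[OF fg(2)]]
  have "(\<forall>z. f (\<gamma> z) * \<gamma> z $ i = 0) \<or> (\<forall>z. g (\<gamma> z) = 0)" by blast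
  then have "f (\<gamma> 0) * \<gamma> 0 $ i = 0 \<or> g (\<gamma> 1) = 0" by blast
  then show False using t t' i \<gamma> by simp
qed

text \<open>The list gives the order in which the parameters become free. The coordinate \<open>q\<close>
  witnesses that freeing the next parameter enlarges the closure.\<close>

lemma parametrized_chain:
  fixes p :: "('v \<Rightarrow> complex) \<Rightarrow> complex ^ 'i::finite"
  assumes X: "closedin zariski X" "\<And>t. p t \<noteq> 0 \<Longrightarrow> p t \<in> \<Union>X"
    and curve: "\<And>t t' i. upoly e (\<lambda>z. p (\<lambda>v. (1 - z) * t v + z * t' v) $ i)"
    and cert: "\<And>k. k < length vs \<Longrightarrow> \<exists>q. (\<forall>t. {v. t v \<noteq> 0} \<subseteq> set (take k vs) \<longrightarrow> p t $ q = 0) \<and>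
      (\<exists>t. {v. t v \<noteq> 0} \<subseteq> set (take (Suc k) vs) \<and> p t $ q \<noteq> 0)"
    and "length vs = Suc D"
  shows "\<exists>Z. (\<forall>j\<le>D. irreducible_closed zariski (Z j) \<and> Z j \<subseteq> X) \<and> (\<forall>j<D. Z j \<subset> Z (Suc j))"
proof -
  define S where "S j = p ` {t. {v. t v \<noteq> 0} \<subseteq> set (take (Suc j) vs)} - {0}" for j
  have irr: "irreducible_closed zariski (line_closure (S j))" if "j \<le> D" for j
  proof (rule irreducible_line_closure)
    have "j < length vs" using that assms(5) by simp
    from cert[OF this] obtain q t where "{v. t v \<noteq> 0} \<subseteq> set (take (Suc j) vs)" "p t $ q \<noteq> 0"
      by blast
    moreover from this have "p t \<noteq> 0" by auto
    ultimately show "S j \<noteq> {}" unfolding S_def by blast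
    show "0 \<notin> S j" by (simp add: S_def)
    show "(\<forall>x\<in>S j. f x = 0) \<or> (\<forall>x\<in>S j. g x = 0)"
      if "form d f" "form e' g" "\<forall>x\<in>S j. f x * g x = 0" for d e' f g
      using that unfolding S_def by (rule parametrized_prime[OF curve])
  qed
  have sub: "line_closure (S j) \<subseteq> X" for j
    by (rule line_closure_subset[OF X(1)]) (use X(2) in \<open>auto simp: S_def\<close>)
  have strict: "line_closure (S j) \<subset> line_closure (S (Suc j))" if "j < D" for j
  proof
    have "set (take (Suc j) vs) \<subseteq> set (take (Suc (Suc j)) vs)"
      by (rule set_take_subset_set_take) simp
    then have "S j \<subseteq> S (Suc j)" unfolding S_def by blast
    then show "line_closure (S j) \<subseteq> line_closure (S (Suc j))"
      by (rule line_closure_mono)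
    have "Suc j < length vs" using that assms(5) by simp
    from cert[OF this] obtain q t where q: "\<forall>t. {v. t v \<noteq> 0} \<subseteq> set (take (Suc j) vs) \<longrightarrow> p t $ q = 0"
      and t: "{v. t v \<noteq> 0} \<subseteq> set (take (Suc (Suc j)) vs)" "p t $ q \<noteq> 0"
      by blast
    have nz: "p t \<noteq> 0" using t(2) by auto
    then have "p t \<in> S (Suc j)" unfolding S_def using t(1) by blast
    then have "vec.span {p t} \<in> line_closure (S (Suc j))"
      using nz by (rule span_in_line_closure)
    moreover have "vec.span {p t} \<notin> line_closure (S j)"
    proof
      assume "vec.span {p t} \<in> line_closure (S j)"
      then have *: "g (p t) = 0" if "form d g" "\<forall>x\<in>S j. g x = 0" for d g
        using that vec.span_base[of "p t" "{p t}"] unfolding line_closure_def zero_lines_def by blast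
      have "p t $ q = 0"
        by (rule *[OF form_coord[of q]]) (use q in \<open>auto simp: S_def\<close>)
      then show False using t(2) by simp
    qed
    ultimately show "line_closure (S j) \<noteq> line_closure (S (Suc j))" by blast
  qed
  show ?thesis
    by (intro exI[of _ "\<lambda>j. line_closure (S j)"]) (use irr sub strict in auto)
qed

section \<open>Krull dimension from charts and chains, and projective space\<close>

lemma krull_dim_eqI:
  assumes X: "closedin zariski X"
    and chain: "\<exists>Z. (\<forall>j\<le>D. irreducible_closed zariski (Z j) \<and> Z j \<subseteq> X) \<and> (\<forall>j<D. Z j \<subset> Z (Suc j))"
    and G: "\<And>d. \<exists>G. finite G \<and> card G \<le> C * (e * d + 1) ^ D \<and> determines_forms G d (\<Union>X)"
  shows "krull_dim (subtopology zariski X) = ereal (real D)"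
  unfolding krull_dim_def irreducible_closed_subtopology[OF X]
proof (rule antisym)
  let ?K = "{ereal (real k) |k. \<exists>Z. (\<forall>j\<le>k. irreducible_closed zariski (Z j) \<and> Z j \<subseteq> X) \<and>
    (\<forall>j<k. Z j \<subset> Z (Suc j))}"
  show "Sup (insert (- 1) ?K) \<le> ereal (real D)"
  proof (rule Sup_least)
    fix y assume "y \<in> insert (- 1) ?K"
    then show "y \<le> ereal (real D)"
    proof
      assume "y = - 1"
      then show ?thesis by (simp add: one_ereal_def)
    next
      assume "y \<in> ?K"
      then obtain k Z where y: "y = ereal (real k)" and
        Z: "\<forall>j\<le>k. irreducible_closed zariski (Z j) \<and> Z j \<subseteq> X" "\<forall>j<k. Z j \<subset> Z (Suc j)"
        by blast
      have "k \<le> D"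
        by (rule chain_length_le[of k Z X C e D, OF _ _ _ G]) (use Z in auto)
      then show ?thesis by (simp add: y)
    qed
  qed
  show "ereal (real D) \<le> Sup (insert (- 1) ?K)"
    by (rule Sup_upper) (use chain in blast)
qed

lemma krull_dim_empty: "krull_dim (subtopology T {}) = - 1"
proof -
  have "\<not> irreducible_closed (subtopology T {}) Z" for Z
    unfolding irreducible_closed_def using closedin_subset[of "subtopology T {}" Z] by auto
  then have no_chain: "{ereal (real k) |k. \<exists>Z. (\<forall>j\<le>k. irreducible_closed (subtopology T {}) (Z j)) \<and>
    (\<forall>j<k. Z j \<subset> Z (Suc j))} = {}" by blast
  show ?thesis unfolding krull_dim_def no_chain by simp
qed

lemma nth_notin_take: "distinct vs \<Longrightarrow> k < length vs \<Longrightarrow> vs ! k \<notin> set (take k vs)"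
  by (auto simp: in_set_conv_nth nth_eq_iff_index_eq)

lemma nth_in_take_Suc: "k < length vs \<Longrightarrow> vs ! k \<in> set (take (Suc k) vs)"
  by (simp add: take_Suc_conv_app_nth)

text \<open>The charts are the standard affine ones, where one coordinate equals 1; the chain consists
  of coordinate subspaces.\<close>

theorem krull_dim_proj_space:
  "krull_dim (zariski :: (complex ^ 'i::finite) set topology) = ereal (real (CARD('i) - 1))"
proof -
  let ?X = "proj_space :: (complex ^ 'i) set set"
  let ?p = "\<lambda>t. (\<chi> i. t i) :: complex ^ 'i"
  have X: "closedin zariski ?X"
    unfolding topspace_zariski[symmetric] by (rule closedin_topspace)
  obtain vs :: "'i list" where vs: "set vs = UNIV" "distinct vs"
    using finite_distinct_list[OF finite] by blast
  have len: "length vs = Suc (CARD('i) - 1)"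
    using distinct_card[OF vs(2)] zero_less_card_finite[where 'a = 'i] unfolding vs(1) by linarith
  have "\<exists>Z. (\<forall>j\<le>CARD('i) - 1. irreducible_closed zariski (Z j) \<and> Z j \<subseteq> ?X) \<and>
    (\<forall>j<CARD('i) - 1. Z j \<subset> Z (Suc j))"
  proof (rule parametrized_chain[where p = ?p and e = 1, OF X _ _ _ len])
    show "?p t \<in> \<Union>?X" if "?p t \<noteq> 0" for t
      using that vec.span_base[of "?p t" "{?p t}"] unfolding proj_space_def by blast
    show "upoly 1 (\<lambda>z. ?p (\<lambda>v. (1 - z) * t v + z * t' v) $ i)" for t t' i
    proof -
      have "upoly 1 (\<lambda>z. t i + z * (t' i - t i))"
        using upoly_add[OF upoly_const upoly_mult[OF upoly_id[of 1] upoly_const[of 0]]] by simp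
      then show ?thesis by (simp add: algebra_simps)
    qed
    show "\<exists>q. (\<forall>t. {v. t v \<noteq> 0} \<subseteq> set (take k vs) \<longrightarrow> ?p t $ q = 0) \<and>
      (\<exists>t. {v. t v \<noteq> 0} \<subseteq> set (take (Suc k) vs) \<and> ?p t $ q \<noteq> 0)" if "k < length vs" for k
    proof (intro exI[of _ "vs ! k"] conjI allI impI)
      show "?p t $ (vs ! k) = 0" if t: "{v. t v \<noteq> 0} \<subseteq> set (take k vs)" for t
        using t nth_notin_take[OF vs(2) \<open>k < length vs\<close>] by auto
      show "\<exists>t. {v. t v \<noteq> 0} \<subseteq> set (take (Suc k) vs) \<and> ?p t $ (vs ! k) \<noteq> 0"
        using nth_in_take_Suc[OF that] by (intro exI[of _ "\<lambda>v. if v = vs ! k then 1 else 0"]) auto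
    qed
  qed
  moreover have "\<exists>G. finite G \<and> card G \<le> card (UNIV :: 'i set) * (1 * d + 1) ^ (CARD('i) - 1) \<and>
    determines_forms G d (\<Union>?X)" for d
  proof (rule charts_determine_forms[where U = "\<lambda>i. - {i}" and p = "\<lambda>_. ?p" and b = "\<lambda>_ _. 1"])
    show "finite (- {i}) \<and> card (- {i}) \<le> CARD('i) - 1" for i :: 'i
      by (simp add: Compl_eq_Diff_UNIV)
    show "upoly 1 (\<lambda>z. ?p (t(v := z)) $ i)" for t v i
      by (cases "v = i") (auto intro: upoly_id upoly_const)
    show "\<exists>c\<in>UNIV. \<exists>t. (\<forall>v. v \<notin> - {c} \<longrightarrow> t v = 1) \<and> L \<subseteq> vec.span {?p t}" if "L \<in> ?X" for L
    proof -
      obtain x where x: "L = vec.span {x}" "x \<noteq> 0" using \<open>L \<in> ?X\<close> by (auto simp: proj_space_def)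
      then obtain i where i: "x $ i \<noteq> 0" by (auto simp: vec_eq_iff)
      have "x = x $ i *s ?p (\<lambda>j. x $ j / x $ i)" using i by (simp add: vec_eq_iff)
      then have "x \<in> vec.span {?p (\<lambda>j. x $ j / x $ i)}"
        by (metis insertI1 vec.span_base vec.span_scale)
      then have "L \<subseteq> vec.span {?p (\<lambda>j. x $ j / x $ i)}"
        unfolding x(1) by (intro vec.span_minimal) auto
      then show ?thesis
        using i by (intro bexI[of _ i] exI[of _ "\<lambda>j. x $ j / x $ i"]) auto
    qed
  qed auto
  ultimately have "krull_dim (subtopology zariski ?X) = ereal (real (CARD('i) - 1))"
    by (rule krull_dim_eqI[OF X])
  then show ?thesis
    unfolding topspace_zariski[symmetric] by simp
qed


section \<open>The singular locus\<close>

text \<open>The formal derivative agrees with the analytic one. This permits the gradient of the cubic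
  to be computed from its values, without expanding it into monomials.\<close>

lemma peval_partial_deriv:
  "((\<lambda>z. peval F (\<chi> j. if j = i then z else x $ j)) has_field_derivative peval (partial_deriv i F) x) (at (x $ i))"
proof -
  have monomial: "((\<lambda>z. c * (\<Prod>j\<in>UNIV. (if j = i then z else x $ j) ^ Poly_Mapping.lookup m j))
      has_field_derivative of_nat (Poly_Mapping.lookup m i) * c *
        (\<Prod>j\<in>UNIV. (x $ j) ^ Poly_Mapping.lookup (m - Poly_Mapping.single i 1) j)) (at (x $ i))" for c m
  proof -
    let ?r = "\<Prod>j\<in>UNIV - {i}. (x $ j) ^ Poly_Mapping.lookup m j"
    have 1: "(\<Prod>j\<in>UNIV. (if j = i then z else x $ j) ^ Poly_Mapping.lookup m j)
        = z ^ Poly_Mapping.lookup m i * ?r" for z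
      by (subst prod.remove[of _ i]) (auto intro!: prod.cong)
    have 2: "(\<Prod>j\<in>UNIV. (x $ j) ^ Poly_Mapping.lookup (m - Poly_Mapping.single i 1) j)
        = (x $ i) ^ (Poly_Mapping.lookup m i - 1) * ?r"
      by (subst prod.remove[of _ i]) (auto simp: lookup_minus lookup_single intro!: prod.cong)
    show ?thesis
      unfolding 1 2 by (auto intro!: derivative_eq_intros)
  qed
  have "peval (partial_deriv i F) x = (\<Sum>m\<in>Poly_Mapping.keys F.
      of_nat (Poly_Mapping.lookup m i) * Poly_Mapping.lookup F m *
      (\<Prod>j\<in>UNIV. (x $ j) ^ Poly_Mapping.lookup (m - Poly_Mapping.single i 1) j))"
    by (simp add: partial_deriv_def peval_sum peval_single)
  then show ?thesis
    unfolding peval_def[of F] using monomial by (auto intro!: DERIV_sum)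
qed

lemma sum_of_bool_pair:
  fixes h :: "'a::finite \<Rightarrow> 'b::finite \<Rightarrow> complex"
  shows "(\<Sum>a\<in>UNIV. \<Sum>b\<in>UNIV. of_bool ((a, b) = p) * h a b) = h (fst p) (snd p)"
proof -
  have "(\<Sum>a\<in>UNIV. \<Sum>b\<in>UNIV. of_bool ((a, b) = p) * h a b)
      = (\<Sum>a\<in>UNIV. if a = fst p then \<Sum>b\<in>UNIV. if b = snd p then h a b else 0 else 0)"
    by (intro sum.cong) (auto simp: prod_eq_iff)
  then show ?thesis by simp
qed

lemma partial_deriv_cubic_of_sM:
  fixes x :: "complex ^ ('n::finite \<times> 'n)"
  shows "peval (partial_deriv (u, v) (cubic_of sM)) x = 3 * (vec_to_mat x ** vec_to_mat x) $ v $ u"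
proof -
  let ?Y = "\<lambda>z. (\<chi> j. if j = (u, v) then z else x $ j) :: complex ^ ('n \<times> 'n)"
  let ?\<delta> = "\<lambda>a b. of_bool ((a, b) = (u, v)) :: complex"
  let ?D = "\<lambda>a b c. ?\<delta> a b * (x $ (b, c) * x $ (c, a)) + ?\<delta> b c * (x $ (a, b) * x $ (c, a))
      + ?\<delta> c a * (x $ (a, b) * x $ (b, c))"
  have trace: "peval (cubic_of sM) y = (\<Sum>a\<in>UNIV. \<Sum>b\<in>UNIV. \<Sum>c\<in>UNIV. y $ (a, b) * y $ (b, c) * y $ (c, a))"
    for y :: "complex ^ ('n \<times> 'n)"
    unfolding peval_cubic_of_sM trace_def matrix_matrix_mult_def vec_to_mat_def
    by (simp add: sum_distrib_right) (intro sum.cong refl sum.swap)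
  have entry: "((\<lambda>z. ?Y z $ (a, b)) has_field_derivative ?\<delta> a b) (at (x $ (u, v)))" for a b
    by (cases "(a, b) = (u, v)") auto
  have at: "?Y (x $ (u, v)) = x" by (simp add: vec_eq_iff)
  have summand: "((\<lambda>z. ?Y z $ (a, b) * ?Y z $ (b, c) * ?Y z $ (c, a)) has_field_derivative ?D a b c) (at (x $ (u, v)))"
    for a b c
    using DERIV_mult[OF DERIV_mult[OF entry[of a b] entry[of b c]] entry[of c a]]
    unfolding at by (simp add: algebra_simps)
  have "((\<lambda>z. peval (cubic_of sM) (?Y z)) has_field_derivative
      (\<Sum>a\<in>UNIV. \<Sum>b\<in>UNIV. \<Sum>c\<in>UNIV. ?D a b c)) (at (x $ (u, v)))"
    unfolding trace by (intro DERIV_sum summand)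
  then have "peval (partial_deriv (u, v) (cubic_of sM)) x = (\<Sum>a\<in>UNIV. \<Sum>b\<in>UNIV. \<Sum>c\<in>UNIV. ?D a b c)"
    using peval_partial_deriv[of "cubic_of sM" "(u, v)" x] by (rule DERIV_unique[rotated])
  also have "\<dots> = (\<Sum>a\<in>UNIV. \<Sum>b\<in>UNIV. ?\<delta> a b * (\<Sum>c\<in>UNIV. x $ (b, c) * x $ (c, a)))
      + (\<Sum>a\<in>UNIV. \<Sum>b\<in>UNIV. \<Sum>c\<in>UNIV. ?\<delta> b c * (x $ (a, b) * x $ (c, a)))
      + (\<Sum>a\<in>UNIV. \<Sum>b\<in>UNIV. \<Sum>c\<in>UNIV. ?\<delta> c a * (x $ (a, b) * x $ (b, c)))"
    by (simp add: sum.distrib sum_distrib_left)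
  also have "(\<Sum>a\<in>UNIV. \<Sum>b\<in>UNIV. ?\<delta> a b * (\<Sum>c\<in>UNIV. x $ (b, c) * x $ (c, a))) = (\<Sum>c\<in>UNIV. x $ (v, c) * x $ (c, u))"
    unfolding sum_of_bool_pair by simp
  also have "(\<Sum>a\<in>UNIV. \<Sum>b\<in>UNIV. \<Sum>c\<in>UNIV. ?\<delta> b c * (x $ (a, b) * x $ (c, a))) = (\<Sum>c\<in>UNIV. x $ (v, c) * x $ (c, u))"
    unfolding sum_of_bool_pair by (simp add: mult.commute)
  also have "(\<Sum>a\<in>UNIV. \<Sum>b\<in>UNIV. \<Sum>c\<in>UNIV. ?\<delta> c a * (x $ (a, b) * x $ (b, c))) =
      (\<Sum>a\<in>UNIV. \<Sum>c\<in>UNIV. ?\<delta> c a * (\<Sum>b\<in>UNIV. x $ (a, b) * x $ (b, c)))"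
    unfolding sum_distrib_left by (intro sum.cong refl sum.swap)
  also have "\<dots> = (\<Sum>c\<in>UNIV. \<Sum>a\<in>UNIV. ?\<delta> c a * (\<Sum>b\<in>UNIV. x $ (a, b) * x $ (b, c)))"
    by (rule sum.swap)
  also have "\<dots> = (\<Sum>c\<in>UNIV. x $ (v, c) * x $ (c, u))"
    unfolding sum_of_bool_pair by simp
  finally show ?thesis
    by (simp add: matrix_matrix_mult_def vec_to_mat_def)
qed

definition square_zero_lines :: "(complex ^ ('n::finite \<times> 'n)) set set" where
  "square_zero_lines = zero_lines (range (\<lambda>(a, b) x. (vec_to_mat x ** vec_to_mat x) $ a $ b))"

lemma form_square_entry: "form 2 (\<lambda>x. (vec_to_mat x ** vec_to_mat x) $ a $ b)"
proof -
  have "form (1 + 1) (\<lambda>x. \<Sum>c\<in>UNIV. x $ (a, c) * x $ (c, b))"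
    by (intro form_sum form_mult form_coord)
  then show ?thesis
    by (simp add: matrix_matrix_mult_def vec_to_mat_def numeral_2_eq_2)
qed

lemma closedin_square_zero_lines: "closedin zariski square_zero_lines"
  unfolding square_zero_lines_def
  by (rule closedin_zero_lines) (use form_square_entry in auto)

lemma mem_square_zero_lines:
  "L \<in> square_zero_lines \<longleftrightarrow> L \<in> proj_space \<and> (\<forall>x\<in>L. vec_to_mat x ** vec_to_mat x = 0)"
  unfolding square_zero_lines_def zero_lines_def by (auto simp: vec_eq_iff)

lemma span_in_square_zero_lines:
  assumes "x \<noteq> 0" "vec_to_mat x ** vec_to_mat x = 0"
  shows "vec.span {x} \<in> square_zero_lines"
proof -
  have "(vec_to_mat y ** vec_to_mat y) $ a $ b = 0" if "y \<in> vec.span {x}" for y a b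
    by (rule form_vanishes_on_line[OF form_square_entry _ that]) (simp add: assms(2))
  then show ?thesis
    using assms(1) unfolding mem_square_zero_lines proj_space_def by (auto simp: vec_eq_iff)
qed

lemma sing_locus_cubic_of_sM:
  "sing_locus (cubic_of sM) = (square_zero_lines :: (complex ^ ('n::finite \<times> 'n)) set set)"
proof -
  have "(\<forall>i. peval (partial_deriv i (cubic_of sM)) x = 0) \<longleftrightarrow> vec_to_mat x ** vec_to_mat x = 0"
    for x :: "complex ^ ('n \<times> 'n)"
    by (auto simp: partial_deriv_cubic_of_sM vec_eq_iff)
  then show ?thesis
    unfolding sing_locus_def proj_zeros_def set_eq_iff mem_square_zero_lines by blast
qed


section \<open>Coordinates on the square-zero matrices\<close>

text \<open>With \<open>W = (t (a, i))\<close> for \<open>a \<in> J\<close> and \<open>i \<notin> J\<close>, the columns of the first matrix span the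
  graph of \<open>W\<close>, and the rows of the third one span the linear forms that vanish on this graph. A matrix with
  image in the graph and kernel containing it is the product of the first matrix, an arbitrary
  block, and the third one. All three are padded with zeros to square matrices, so that no type
  for the size of the blocks is needed, and \<open>t\<close> stores the block and \<open>W\<close> in disjoint sets of
  index pairs.\<close>

definition graph_mat :: "'n set \<Rightarrow> ('n \<times> 'n \<Rightarrow> complex) \<Rightarrow> complex ^ 'n ^ 'n::finite" where
  "graph_mat J t = (\<chi> a i. if i \<in> J then 0 else if a \<in> J then t (a, i) else of_bool (a = i))"

definition core_mat :: "'n set \<Rightarrow> ('n \<times> 'n \<Rightarrow> complex) \<Rightarrow> complex ^ 'n ^ 'n::finite" where
  "core_mat J t = (\<chi> i j. if i \<notin> J \<and> j \<in> J then t (i, j) else 0)"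

definition annihilator_mat :: "'n set \<Rightarrow> ('n \<times> 'n \<Rightarrow> complex) \<Rightarrow> complex ^ 'n ^ 'n::finite" where
  "annihilator_mat J t = (\<chi> j b. if j \<notin> J then 0 else if b \<in> J then of_bool (j = b) else - t (j, b))"

definition square_zero_param :: "'n set \<Rightarrow> ('n \<times> 'n \<Rightarrow> complex) \<Rightarrow> complex ^ ('n::finite \<times> 'n)" where
  "square_zero_param J t =
     (\<chi> q. (graph_mat J t ** core_mat J t ** annihilator_mat J t) $ fst q $ snd q)"

lemma vec_to_mat_square_zero_param:
  "vec_to_mat (square_zero_param J t) = graph_mat J t ** core_mat J t ** annihilator_mat J t"
  by (simp add: square_zero_param_def vec_to_mat_def vec_eq_iff)

lemma sum_of_bool_mult: "(\<Sum>c\<in>UNIV. of_bool (c = b) * h c) = (h b :: complex)"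
  "(\<Sum>c\<in>UNIV. of_bool (b = c) * h c) = h b"
  "(\<Sum>c\<in>UNIV. h c * of_bool (c = b)) = h b"
  "(\<Sum>c\<in>UNIV. h c * of_bool (b = c)) = h b" for b :: "'n::finite"
  by (simp_all add: of_bool_def if_distrib[of "\<lambda>x. x * _"] if_distrib[of "\<lambda>x. _ * x"] cong: if_cong)

lemma annihilator_graph: "annihilator_mat J t ** graph_mat J t = 0"
proof -
  have "(\<Sum>c\<in>UNIV. annihilator_mat J t $ j $ c * graph_mat J t $ c $ i) = 0" for j i
  proof (cases "j \<in> J \<and> i \<notin> J")
    case True
    then have "(\<Sum>c\<in>UNIV. annihilator_mat J t $ j $ c * graph_mat J t $ c $ i)
       = (\<Sum>c\<in>UNIV. of_bool (c = j) * t (c, i) - t (j, c) * of_bool (c = i))"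
      by (intro sum.cong) (auto simp: annihilator_mat_def graph_mat_def)
    then show ?thesis by (simp add: sum_subtractf sum_of_bool_mult)
  qed (auto simp: annihilator_mat_def graph_mat_def)
  then show ?thesis by (simp add: vec_eq_iff matrix_matrix_mult_def)
qed

lemma square_zero_param_square:
  "vec_to_mat (square_zero_param J t) ** vec_to_mat (square_zero_param J t) = 0"
proof -
  let ?L = "graph_mat J t" and ?T = "core_mat J t" and ?R = "annihilator_mat J t"
  have "(?L ** ?T ** ?R) ** (?L ** ?T ** ?R) = ?L ** ?T ** (?R ** ?L) ** (?T ** ?R)"
    by (simp only: matrix_mul_assoc)
  also have "\<dots> = 0"
    unfolding annihilator_graph by (simp add: matrix_matrix_mult_def vec_eq_iff)
  finally show ?thesis by (simp add: vec_to_mat_square_zero_param)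
qed

lemma square_zero_param_upoly:
  assumes "\<And>v. upoly 1 (\<lambda>z. \<tau> z v)"
  shows "upoly 3 (\<lambda>z. square_zero_param J (\<tau> z) $ q)"
proof -
  have L: "upoly 1 (\<lambda>z. graph_mat J (\<tau> z) $ a $ i)" for a i
    unfolding graph_mat_def vec_lambda_beta by (intro upoly_if upoly_const assms)
  have T: "upoly 1 (\<lambda>z. core_mat J (\<tau> z) $ i $ j)" for i j
    unfolding core_mat_def vec_lambda_beta by (intro upoly_if upoly_const assms)
  have R: "upoly 1 (\<lambda>z. annihilator_mat J (\<tau> z) $ j $ b)" for j b
    unfolding annihilator_mat_def vec_lambda_beta by (intro upoly_if upoly_const upoly_uminus assms)
  have "upoly (1 + 1 + 1) (\<lambda>z. \<Sum>j\<in>UNIV. (\<Sum>i\<in>UNIV. graph_mat J (\<tau> z) $ fst q $ i *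
      core_mat J (\<tau> z) $ i $ j) * annihilator_mat J (\<tau> z) $ j $ snd q)"
    by (intro upoly_sum upoly_mult L T R)
  then show ?thesis
    by (simp add: square_zero_param_def matrix_matrix_mult_def numeral_3_eq_3)
qed

lemma square_zero_param_entry:
  "square_zero_param J t $ (a, b) =
     (\<Sum>j\<in>UNIV. (\<Sum>i\<in>UNIV. graph_mat J t $ a $ i * core_mat J t $ i $ j) * annihilator_mat J t $ j $ b)"
  by (simp add: square_zero_param_def matrix_matrix_mult_def)

lemma square_zero_param_entry_core:
  assumes "i \<notin> J" "j \<in> J"
  shows "square_zero_param J t $ (i, j) = t (i, j)"
proof -
  have 1: "(\<Sum>l\<in>UNIV. graph_mat J t $ i $ l * core_mat J t $ l $ c) = core_mat J t $ i $ c" for c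
  proof -
    have "(\<Sum>l\<in>UNIV. graph_mat J t $ i $ l * core_mat J t $ l $ c)
        = (\<Sum>l\<in>UNIV. of_bool (i = l) * core_mat J t $ l $ c)"
      using assms by (intro sum.cong) (auto simp: graph_mat_def core_mat_def)
    then show ?thesis by (simp add: sum_of_bool_mult)
  qed
  have "square_zero_param J t $ (i, j) = (\<Sum>c\<in>UNIV. core_mat J t $ i $ c * of_bool (c = j))"
    unfolding square_zero_param_entry 1
    using assms by (intro sum.cong) (auto simp: annihilator_mat_def core_mat_def)
  then show ?thesis
    using assms by (simp add: sum_of_bool_mult core_mat_def)
qed

text \<open>This block is the product of \<open>W\<close> with the core, and its entries detect the parameters in
  \<open>W\<close>.\<close>

lemma square_zero_param_entry_lower:
  assumes "a \<in> J" "b \<in> J"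
  shows "square_zero_param J t $ (a, b) = (\<Sum>i\<in>-J. t (a, i) * t (i, b))"
proof -
  have 1: "(\<Sum>i\<in>UNIV. graph_mat J t $ a $ i * core_mat J t $ i $ c) = of_bool (c \<in> J) * (\<Sum>i\<in>-J. t (a, i) * t (i, c))" for c
  proof -
    have "(\<Sum>i\<in>-J. graph_mat J t $ a $ i * core_mat J t $ i $ c) = (\<Sum>i\<in>UNIV. graph_mat J t $ a $ i * core_mat J t $ i $ c)"
      by (rule sum.mono_neutral_left) (auto simp: graph_mat_def)
    moreover have "(\<Sum>i\<in>-J. graph_mat J t $ a $ i * core_mat J t $ i $ c) = (\<Sum>i\<in>-J. of_bool (c \<in> J) * (t (a, i) * t (i, c)))"
      using assms by (intro sum.cong) (auto simp: graph_mat_def core_mat_def)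
    ultimately show ?thesis by (simp add: sum_distrib_left)
  qed
  have "square_zero_param J t $ (a, b) = (\<Sum>c\<in>UNIV. (\<Sum>i\<in>-J. t (a, i) * t (i, c)) * of_bool (c = b))"
    unfolding square_zero_param_entry 1
    using assms by (intro sum.cong) (auto simp: annihilator_mat_def)
  then show ?thesis
    by (simp add: sum_of_bool_mult)
qed

text \<open>\<open>J\<close> is chosen maximal such that the image of \<open>A\<close> meets the coordinate space of \<open>J\<close> only
  in zero. By maximality, for every \<open>i \<notin> J\<close> the image contains a vector \<open>A u\<^sub>i\<close> which is the \<open>i\<close>-th
  unit vector up to entries in \<open>J\<close>. These vectors form a basis of the image, which gives one of the two factors,
  and they are annihilated by \<open>A\<close>, which gives the other one.\<close>

lemma square_zero_has_param:
  fixes A :: "complex ^ 'n ^ 'n::finite"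
  assumes sq: "A ** A = 0"
  shows "\<exists>J t. A = graph_mat J t ** core_mat J t ** annihilator_mat J t"
proof -
  have sqv: "A *v (A *v x) = 0" for x
    by (simp add: matrix_vector_mul_assoc sq)
  define P where "P J \<longleftrightarrow> (\<forall>x. (\<forall>i. i \<notin> J \<longrightarrow> (A *v x) $ i = 0) \<longrightarrow> A *v x = 0)" for J
  have "P {}" unfolding P_def by (simp add: vec_eq_iff)
  then obtain J where J: "P J" and max: "\<And>J'. P J' \<Longrightarrow> J \<subseteq> J' \<Longrightarrow> J = J'"
    using finite_has_maximal[of "Collect P"] by auto
  have "\<exists>y. (A *v y) $ i = 1 \<and> (\<forall>l. l \<notin> J \<and> l \<noteq> i \<longrightarrow> (A *v y) $ l = 0)" if i: "i \<notin> J" for i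
  proof -
    have "\<not> P (insert i J)" using max[of "insert i J"] i by blast
    then obtain x where x: "\<forall>l. l \<notin> insert i J \<longrightarrow> (A *v x) $ l = 0" "A *v x \<noteq> 0"
      unfolding P_def by blast
    have nz: "(A *v x) $ i \<noteq> 0"
    proof
      assume "(A *v x) $ i = 0"
      then have "\<forall>l. l \<notin> J \<longrightarrow> (A *v x) $ l = 0" using x(1) by (metis insertE)
      then show False using J x(2) unfolding P_def by blast
    qed
    have "A *v ((1 / (A *v x) $ i) *s x) = (1 / (A *v x) $ i) *s (A *v x)"
      by (rule vector_scalar_commute)
    then show ?thesis
      using x(1) nz by (intro exI[of _ "(1 / (A *v x) $ i) *s x"]) auto
  qed
  then obtain u where u: "\<And>i. i \<notin> J \<Longrightarrow> (A *v u i) $ i = 1"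
    "\<And>i l. i \<notin> J \<Longrightarrow> l \<notin> J \<Longrightarrow> l \<noteq> i \<Longrightarrow> (A *v u i) $ l = 0"
    by metis
  define t where "t = (\<lambda>(a, b). if a \<in> J then (A *v u b) $ a else A $ a $ b)"
  have AR: "A ** annihilator_mat J t = A"
  proof -
    have "(\<Sum>j\<in>UNIV. A $ a $ j * annihilator_mat J t $ j $ b) = A $ a $ b" for a b
    proof (cases "b \<in> J")
      case True
      then have "(\<Sum>j\<in>UNIV. A $ a $ j * annihilator_mat J t $ j $ b) = (\<Sum>j\<in>UNIV. A $ a $ j * of_bool (j = b))"
        by (intro sum.cong) (auto simp: annihilator_mat_def)
      then show ?thesis by (simp add: sum_of_bool_mult)
    next
      case False
      have "(\<Sum>j\<in>UNIV. A $ a $ j * annihilator_mat J t $ j $ b)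
          = (\<Sum>j\<in>UNIV. A $ a $ j * of_bool (j = b) - A $ a $ j * (A *v u b) $ j)"
        using False u by (intro sum.cong) (auto simp: annihilator_mat_def t_def)
      also have "\<dots> = A $ a $ b - (A *v (A *v u b)) $ a"
        by (simp add: sum_subtractf sum_of_bool_mult matrix_vector_mult_def)
      finally show ?thesis by (simp add: sqv)
    qed
    then show ?thesis by (simp add: vec_eq_iff matrix_matrix_mult_def)
  qed
  have LA: "graph_mat J t ** A = A"
  proof -
    have "(\<Sum>i\<in>UNIV. graph_mat J t $ a $ i * A $ i $ b) = A $ a $ b" for a b
    proof -
      \<comment> \<open>The vector \<open>A y\<close> is column \<open>b\<close> of \<open>A\<close> reduced by the basis \<open>A u\<^sub>i\<close>, so its entries outside of \<open>J\<close> vanish.\<close>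
      define y where "y = axis b 1 - (\<Sum>i\<in>-J. A $ i $ b *s u i)"
      have "(A *v axis b 1) $ l = A $ l $ b" for l
        by (simp add: matrix_vector_mult_def axis_def if_distrib[of "\<lambda>z. _ * z"] cong: if_cong)
      then have Ay: "(A *v y) $ l = A $ l $ b - (\<Sum>i\<in>-J. A $ i $ b * (A *v u i) $ l)" for l
        by (simp add: y_def matrix_vector_mult_diff_distrib linear_sum[OF matrix_vector_mul_linear]
            vector_scalar_commute)
      have "(A *v y) $ l = 0" if l: "l \<notin> J" for l
      proof -
        have "(\<Sum>i\<in>-J. A $ i $ b * (A *v u i) $ l) = (\<Sum>i\<in>{l}. A $ i $ b * (A *v u i) $ l)"
          by (rule sum.mono_neutral_right) (use l u(2) in auto)
        then show ?thesis using u(1)[OF l] by (simp add: Ay)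
      qed
      then have "A *v y = 0" using J unfolding P_def by blast
      then have "A $ a $ b = (\<Sum>i\<in>-J. A $ i $ b * (A *v u i) $ a)"
        using Ay[of a] by simp
      also have "\<dots> = (\<Sum>i\<in>-J. graph_mat J t $ a $ i * A $ i $ b)"
        using u by (intro sum.cong) (auto simp: graph_mat_def t_def)
      also have "\<dots> = (\<Sum>i\<in>UNIV. graph_mat J t $ a $ i * A $ i $ b)"
        by (rule sum.mono_neutral_left) (auto simp: graph_mat_def)
      finally show ?thesis by simp
    qed
    then show ?thesis by (simp add: vec_eq_iff matrix_matrix_mult_def)
  qed
  have "graph_mat J t ** core_mat J t ** annihilator_mat J t = graph_mat J t ** A ** annihilator_mat J t"
    unfolding matrix_matrix_mult_def
    by (simp add: vec_eq_iff sum_distrib_right, intro allI sum.cong refl)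
       (auto simp: graph_mat_def core_mat_def annihilator_mat_def t_def)
  then show ?thesis using AR LA by metis
qed

lemma square_zero_param_scale:
  assumes "t (i, j) \<noteq> 0"
  shows "square_zero_param J t = t (i, j) *s square_zero_param J
    (\<lambda>(a, b). if a \<notin> J \<and> b \<in> J then t (a, b) / t (i, j) else if a \<in> J \<and> b \<notin> J then t (a, b) else 0)"
    (is "_ = _ *s square_zero_param J ?t")
proof -
  have "graph_mat J ?t = graph_mat J t" "annihilator_mat J ?t = annihilator_mat J t"
    by (auto simp: graph_mat_def annihilator_mat_def vec_eq_iff)
  moreover have "core_mat J t $ a $ b = t (i, j) * core_mat J ?t $ a $ b" for a b
    using assms by (simp add: core_mat_def)
  ultimately show ?thesis
    by (simp add: vec_eq_iff square_zero_param_entry sum_distrib_left sum_distrib_right mult_ac)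
qed


section \<open>The dimension of the square-zero locus\<close>

lemma double_product_le: "2 * (k * l) \<le> (k + l)\<^sup>2 div (2::nat)"
proof -
  have "4 * (int k * int l) \<le> (int k + int l)\<^sup>2"
    using zero_le_power2[of "int k - int l"] by (simp add: power2_eq_square algebra_simps)
  then have "int (4 * (k * l)) \<le> int ((k + l)\<^sup>2)" by simp
  then have "4 * (k * l) \<le> (k + l)\<^sup>2" by linarith
  then show ?thesis by linarith
qed

text \<open>The map is linear in its core, so on a line one nonzero core entry can be
  normalized to 1. This saves the one parameter by which the projective dimension is smaller.\<close>

lemma square_zero_line_has_chart:
  fixes L :: "(complex ^ ('n::finite \<times> 'n)) set"
  assumes "L \<in> square_zero_lines"
  shows "\<exists>J i j t. i \<notin> J \<and> j \<in> J \<and> t (i, j) = 1 \<and>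
    (\<forall>a b. (a \<in> J \<longleftrightarrow> b \<in> J) \<longrightarrow> t (a, b) = 0) \<and> L \<subseteq> vec.span {square_zero_param J t}"
proof -
  obtain x where x: "L = vec.span {x}" "x \<noteq> 0"
    using assms by (auto simp: mem_square_zero_lines proj_space_def)
  then have "vec_to_mat x ** vec_to_mat x = 0"
    using assms vec.span_base[of x "{x}"] by (auto simp: mem_square_zero_lines)
  then obtain J t where "vec_to_mat x = graph_mat J t ** core_mat J t ** annihilator_mat J t"
    using square_zero_has_param by blast
  then have xt: "x = square_zero_param J t"
    unfolding square_zero_param_def by (simp add: vec_eq_iff flip: vec_to_mat_def) (simp add: vec_to_mat_def)
  obtain i j where ij: "i \<notin> J" "j \<in> J" "t (i, j) \<noteq> 0"
  proof -
    have "\<exists>i j. core_mat J t $ i $ j \<noteq> 0"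
    proof (rule ccontr)
      assume "\<not> ?thesis"
      then have "square_zero_param J t = 0"
        by (simp add: vec_eq_iff square_zero_param_entry)
      then show False using x(2) xt by simp
    qed
    then show thesis using that by (auto simp: core_mat_def split: if_splits)
  qed
  let ?t = "\<lambda>(a, b). if a \<notin> J \<and> b \<in> J then t (a, b) / t (i, j) else if a \<in> J \<and> b \<notin> J then t (a, b) else 0"
  have "x \<in> vec.span {square_zero_param J ?t}"
    unfolding xt square_zero_param_scale[of t i j J, OF ij(3)]
    by (intro vec.span_scale vec.span_base) simp
  then have "L \<subseteq> vec.span {square_zero_param J ?t}"
    unfolding x(1) by (intro vec.span_minimal) auto
  then show ?thesis
    using ij by (intro exI[of _ J] exI[of _ i] exI[of _ j] exI[of _ ?t]) auto
qed

lemma square_zero_lines_determined: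
  "\<exists>G. finite G \<and>
     card G \<le> card {(J, i, j). i \<notin> J \<and> (j :: 'n::finite) \<in> J} * (3 * d + 1) ^ (CARD('n)\<^sup>2 div 2 - 1) \<and>
     determines_forms G d (\<Union>(square_zero_lines :: (complex ^ ('n \<times> 'n)) set set))"
proof (rule charts_determine_forms[where p = "\<lambda>(J, i, j). square_zero_param J"
      and U = "\<lambda>(J, i, j). ((- J) \<times> J \<union> J \<times> (- J)) - {(i, j)}"
      and b = "\<lambda>(J, i, j) v. of_bool (v = (i, j))"])
  let ?Cs = "{(J, i, j). i \<notin> J \<and> (j :: 'n) \<in> J}"
  show "finite ?Cs" by simp
  show "finite (case c of (J, i, j) \<Rightarrow> ((- J) \<times> J \<union> J \<times> (- J)) - {(i, j)}) \<and>
     card (case c of (J, i, j) \<Rightarrow> ((- J) \<times> J \<union> J \<times> (- J)) - {(i, j)}) \<le> CARD('n)\<^sup>2 div 2 - 1"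
    if "c \<in> ?Cs" for c
  proof -
    obtain J i j where c: "c = (J, i, j)" by (cases c)
    have ij: "i \<notin> J" "j \<in> J" using that c by auto
    have "card ((- J) \<times> J \<union> J \<times> (- J)) = 2 * (card J * card (- J))"
      by (subst card_Un_disjoint) (auto simp: card_cartesian_product)
    also have "\<dots> \<le> (card J + card (- J))\<^sup>2 div 2" by (rule double_product_le)
    also have "card J + card (- J) = CARD('n)"
      by (subst card_Un_disjoint[symmetric]) (auto simp: Compl_partition)
    finally have "card (((- J) \<times> J \<union> J \<times> (- J)) - {(i, j)}) \<le> CARD('n)\<^sup>2 div 2 - 1"
      using ij by (subst card_Diff_singleton) auto
    then show ?thesis by (simp add: c)
  qed
  show "upoly 3 (\<lambda>z. (case c of (J, i, j) \<Rightarrow> square_zero_param J) (t(v := z)) $ q)" for c t v q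
  proof -
    have "upoly 1 (\<lambda>z. (t(v := z)) w)" for w
      by (cases "w = v") (auto intro: upoly_id upoly_const)
    then show ?thesis by (cases c) (simp only: prod.case square_zero_param_upoly)
  qed
  show "\<exists>c\<in>?Cs. \<exists>t. (\<forall>v. v \<notin> (case c of (J, i, j) \<Rightarrow> ((- J) \<times> J \<union> J \<times> (- J)) - {(i, j)}) \<longrightarrow>
      t v = (case c of (J, i, j) \<Rightarrow> \<lambda>v. of_bool (v = (i, j))) v) \<and>
      L \<subseteq> vec.span {(case c of (J, i, j) \<Rightarrow> square_zero_param J) t}"
    if L: "L \<in> square_zero_lines" for L :: "(complex ^ ('n \<times> 'n)) set"
  proof -
    obtain J i j t where t: "i \<notin> J" "j \<in> J" "t (i, j) = 1"
      "\<forall>a b. (a \<in> J \<longleftrightarrow> b \<in> J) \<longrightarrow> t (a, b) = 0" "L \<subseteq> vec.span {square_zero_param J t}"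
      using square_zero_line_has_chart[OF L] by blast
    then show ?thesis
      by (intro bexI[of _ "(J, i, j)"] exI[of _ t]) auto
  qed
qed

text \<open>Let \<open>I\<close> be half of the indices, \<open>J\<close> its complement and \<open>\<sigma>\<close> an injection of \<open>I\<close> into \<open>J\<close>.
  The parameters become free in the following order: the diagonal core entries \<open>(i, \<sigma> i)\<close>, the
  entries of \<open>W\<close>, the remaining core entries. A core entry is its own witness. As long as only
  diagonal core entries are free, the entry \<open>(j, \<sigma> i)\<close> of the matrix is \<open>t (j, i) t (i, \<sigma> i)\<close> and
  witnesses that \<open>(j, i)\<close> has become free. With the whole core free, \<open>W\<close> could only be recovered by inverting a block of
  it, hence this order.\<close>

lemma square_zero_lines_chain:
  assumes "2 \<le> CARD('n::finite)"
  defines "D \<equiv> CARD('n)\<^sup>2 div 2 - 1"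
  shows "\<exists>Z. (\<forall>j\<le>D. irreducible_closed zariski (Z j) \<and>
    Z j \<subseteq> (square_zero_lines :: (complex ^ ('n \<times> 'n)) set set)) \<and> (\<forall>j<D. Z j \<subset> Z (Suc j))"
proof -
  obtain I :: "'n set" where I: "card I = CARD('n) div 2"
    using obtain_subset_with_card_n[of "CARD('n) div 2" "UNIV :: 'n set"] by auto
  define J where "J = - I"
  have cJ: "card J = CARD('n) - CARD('n) div 2"
    unfolding J_def Compl_eq_Diff_UNIV by (simp add: card_Diff_subset I)
  then have "card I \<le> card J" using I by simp
  then obtain \<sigma> where \<sigma>: "\<sigma> ` I \<subseteq> J" "inj_on \<sigma> I"
    using card_le_inj[of I J] by auto
  define Ds where "Ds = (\<lambda>i. (i, \<sigma> i)) ` I"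
  have Ds: "Ds \<subseteq> I \<times> J" using \<sigma> by (auto simp: Ds_def)
  obtain ds ws os where lists: "set ds = Ds" "distinct ds" "set ws = J \<times> I" "distinct ws"
    "set os = I \<times> J - Ds" "distinct os"
    using finite_distinct_list[OF finite] by metis
  define vs where "vs = ds @ ws @ os"
  have dist: "distinct vs"
    unfolding vs_def using lists Ds by (auto simp: J_def)
  have setvs: "set vs = J \<times> I \<union> I \<times> J"
    unfolding vs_def using lists Ds by auto
  have "length vs = card (J \<times> I \<union> I \<times> J)"
    using distinct_card[OF dist] setvs by simp
  also have "\<dots> = 2 * (card I * card J)"
    by (subst card_Un_disjoint) (auto simp: J_def card_cartesian_product)
  also have "\<dots> = CARD('n)\<^sup>2 div 2"
  proof (cases "even (CARD('n))")
    case True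
    then obtain m where "CARD('n) = 2 * m" by blast
    then show ?thesis using I cJ by (simp add: power2_eq_square)
  next
    case False
    then obtain m where "CARD('n) = 2 * m + 1" by (rule oddE)
    then show ?thesis using I cJ by (simp add: power2_eq_square algebra_simps)
  qed
  also have "\<dots> = Suc D"
  proof -
    have "2\<^sup>2 \<le> CARD('n)\<^sup>2" using assms(1) by (rule power_mono) simp
    then show ?thesis by (simp add: D_def)
  qed
  finally have len: "length vs = Suc D" .
  show ?thesis
  proof (rule parametrized_chain[where p = "square_zero_param J" and e = 3, OF closedin_square_zero_lines _ _ _ len])
    show "square_zero_param J t \<in> \<Union>square_zero_lines" if "square_zero_param J t \<noteq> 0" for t
      using span_in_square_zero_lines[OF that square_zero_param_square] vec.span_base by blast
    show "upoly 3 (\<lambda>z. square_zero_param J (\<lambda>v. (1 - z) * t v + z * t' v) $ q)" for t t' q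
    proof (rule square_zero_param_upoly)
      fix v
      have "upoly 1 (\<lambda>z. t v + z * (t' v - t v))"
        using upoly_add[OF upoly_const upoly_mult[OF upoly_id[of 1] upoly_const[of 0]]] by simp
      then show "upoly 1 (\<lambda>z. (1 - z) * t v + z * t' v)" by (simp add: algebra_simps)
    qed
    fix k assume k: "k < length vs"
    let ?v = "vs ! k"
    have notin: "?v \<notin> set (take k vs)" by (rule nth_notin_take[OF dist k])
    have v_in: "?v \<in> set (take (Suc k) vs)" by (rule nth_in_take_Suc[OF k])
    have "?v \<in> I \<times> J \<or> ?v \<in> J \<times> I" using nth_mem[OF k] setvs by blast
    then show "\<exists>q. (\<forall>t. {v. t v \<noteq> 0} \<subseteq> set (take k vs) \<longrightarrow> square_zero_param J t $ q = 0) \<and>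
      (\<exists>t. {v. t v \<noteq> 0} \<subseteq> set (take (Suc k) vs) \<and> square_zero_param J t $ q \<noteq> 0)"
    proof
      assume "?v \<in> I \<times> J"
      then have entry: "square_zero_param J t $ ?v = t ?v" for t
        using square_zero_param_entry_core[of "fst ?v" J "snd ?v" t] by (auto simp: J_def mem_Times_iff)
      show ?thesis
      proof (intro exI[of _ ?v] conjI allI impI)
        show "square_zero_param J t $ ?v = 0" if "{v. t v \<noteq> 0} \<subseteq> set (take k vs)" for t
          unfolding entry using that notin by blast
        show "\<exists>t. {v. t v \<noteq> 0} \<subseteq> set (take (Suc k) vs) \<and> square_zero_param J t $ ?v \<noteq> 0"
          using v_in by (intro exI[of _ "\<lambda>v. of_bool (v = ?v)"]) (auto simp: entry)
      qed
    next
      assume "?v \<in> J \<times> I"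
      then obtain j i where v: "?v = (j, i)" "j \<in> J" "i \<in> I" by blast
      then have \<sigma>i: "\<sigma> i \<in> J" using \<sigma>(1) by blast
      have entry: "square_zero_param J t $ (j, \<sigma> i) = (\<Sum>l\<in>I. t (j, l) * t (l, \<sigma> i))" for t
        using square_zero_param_entry_lower[OF v(2) \<sigma>i, of t] by (simp add: J_def)
      \<comment> \<open>The parameter lies in the middle part of the list: all of \<open>Ds\<close> is free, no other core entry is.\<close>
      have "?v \<notin> Ds" "?v \<notin> I \<times> J - Ds" using v Ds by (auto simp: J_def)
      then have k1: "length ds \<le> k" and k2: "k < length (ds @ ws)"
        using k nth_mem[of k ds] nth_mem[of "k - length (ds @ ws)" os] lists
        by (auto simp: vs_def nth_append not_le split: if_splits)
      have sub: "set (take k vs) \<subseteq> Ds \<union> J \<times> I"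
      proof -
        have "take k vs = take k (ds @ ws)" using k2 by (simp add: vs_def)
        then have "set (take k vs) \<subseteq> set (ds @ ws)" using set_take_subset by metis
        then show ?thesis using lists by simp
      qed
      have sup: "Ds \<subseteq> set (take (Suc k) vs)"
        using k1 lists by (auto simp: vs_def)
      show ?thesis
      proof (intro exI[of _ "(j, \<sigma> i)"] conjI allI impI)
        fix t :: "'n \<times> 'n \<Rightarrow> complex" assume t: "{v. t v \<noteq> 0} \<subseteq> set (take k vs)"
        have "t (j, l) * t (l, \<sigma> i) = 0" if l: "l \<in> I" for l
        proof (cases "l = i")
          case True
          then have "t (j, l) = 0" using t notin v(1) by auto
          then show ?thesis by simp
        next
          case False
          have "(l, \<sigma> i) \<notin> Ds \<union> J \<times> I"
            using False l v(3) \<sigma>(2) by (auto simp: Ds_def J_def inj_on_def)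
          then have "t (l, \<sigma> i) = 0" using t sub by blast
          then show ?thesis by simp
        qed
        then show "square_zero_param J t $ (j, \<sigma> i) = 0"
          unfolding entry by (intro sum.neutral) blast
      next
        let ?t = "\<lambda>v. of_bool (v = (j, i) \<or> v = (i, \<sigma> i)) :: complex"
        have "square_zero_param J ?t $ (j, \<sigma> i) = (\<Sum>l\<in>{i}. ?t (j, l) * ?t (l, \<sigma> i))"
          unfolding entry by (rule sum.mono_neutral_right) (use v in \<open>auto simp: J_def\<close>)
        moreover have "{v. ?t v \<noteq> 0} \<subseteq> set (take (Suc k) vs)"
          using v_in v sup by (auto simp: Ds_def)
        ultimately show "\<exists>t. {v. t v \<noteq> 0} \<subseteq> set (take (Suc k) vs) \<and> square_zero_param J t $ (j, \<sigma> i) \<noteq> 0"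
          by (intro exI[of _ ?t]) auto
      qed
    qed
  qed
qed

theorem krull_dim_square_zero_lines:
  assumes "2 \<le> CARD('n::finite)"
  shows "krull_dim (subtopology zariski (square_zero_lines :: (complex ^ ('n \<times> 'n)) set set))
    = ereal (real (CARD('n)\<^sup>2 div 2 - 1))"
  by (rule krull_dim_eqI[OF closedin_square_zero_lines square_zero_lines_chain[OF assms]
        square_zero_lines_determined])

lemma square_zero_lines_empty:
  assumes "CARD('n::finite) = 1"
  shows "(square_zero_lines :: (complex ^ ('n \<times> 'n)) set set) = {}"
proof (rule ccontr)
  assume "\<not> ?thesis"
  then obtain L :: "(complex ^ ('n \<times> 'n)) set" where L: "L \<in> square_zero_lines" by blast
  obtain J and i j :: 'n where "i \<notin> J" "j \<in> J"
    using square_zero_line_has_chart[OF L] by blast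
  then have "i \<noteq> j" by blast
  moreover obtain a :: 'n where "UNIV = {a}" using assms by (rule card_1_singletonE)
  ultimately show False by (metis UNIV_I singletonD)
qed

theorem corollary5p7:
  fixes n :: nat
  assumes "CARD('n::finite) = n + 1"
  shows "(odd n \<longrightarrow>
            sgr (sM :: complex ^ ('n \<times> 'n) \<Rightarrow> complex ^ ('n \<times> 'n) \<Rightarrow> complex ^ ('n \<times> 'n) \<Rightarrow> complex)
              = ereal ((real n + 1)^2 / 2))
       \<and> (even n \<longrightarrow>
            sgr (sM :: complex ^ ('n \<times> 'n) \<Rightarrow> complex ^ ('n \<times> 'n) \<Rightarrow> complex ^ ('n \<times> 'n) \<Rightarrow> complex)
              = ereal (((real n + 1)^2 + 1) / 2))"
proof -
  let ?sgr = "sgr (sM :: complex ^ ('n \<times> 'n) \<Rightarrow> complex ^ ('n \<times> 'n) \<Rightarrow> complex ^ ('n \<times> 'n) \<Rightarrow> complex)"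
  have "CARD('n \<times> 'n) = (n + 1)\<^sup>2"
    by (simp add: assms power2_eq_square)
  then have sgr: "?sgr = ereal (real ((n + 1)\<^sup>2 - 1)) -
      krull_dim (subtopology zariski (square_zero_lines :: (complex ^ ('n \<times> 'n)) set set))"
    by (simp only: sgr_def proj_codim_def sing_locus_cubic_of_sM krull_dim_proj_space)
  have one_le: "1 \<le> (n + 1)\<^sup>2" by simp
  show ?thesis
  proof (cases "n = 0")
    case True
    then have "(square_zero_lines :: (complex ^ ('n \<times> 'n)) set set) = {}"
      using assms by (intro square_zero_lines_empty) simp
    then have "?sgr = 1"
      unfolding sgr using True by (simp only: krull_dim_empty) (simp add: one_ereal_def)
    then show ?thesis using True by (simp add: one_ereal_def)
  next
    case False
    then have "2\<^sup>2 \<le> (n + 1)\<^sup>2" by (intro power_mono) auto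
    then have le: "1 \<le> (n + 1)\<^sup>2 div 2" by simp
    have "krull_dim (subtopology zariski (square_zero_lines :: (complex ^ ('n \<times> 'n)) set set))
        = ereal (real ((n + 1)\<^sup>2 div 2 - 1))"
      using krull_dim_square_zero_lines[where 'n = 'n] False assms by simp
    then have s: "?sgr = ereal (real ((n + 1)\<^sup>2) - real ((n + 1)\<^sup>2 div 2))"
      unfolding sgr using le one_le by (simp add: of_nat_diff)
    show ?thesis
    proof (intro conjI impI)
      assume "odd n"
      then have "even ((n + 1)\<^sup>2)" by simp
      then have "real ((n + 1)\<^sup>2 div 2) = real ((n + 1)\<^sup>2) / 2" by (simp add: real_of_nat_div)
      then show "?sgr = ereal ((real n + 1)^2 / 2)" unfolding s by (simp add: algebra_simps)
    next
      assume "even n"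
      then have "odd ((n + 1)\<^sup>2)" by simp
      then obtain m where m: "(n + 1)\<^sup>2 = 2 * m + 1" by (rule oddE)
      then have "(real n + 1)\<^sup>2 = 2 * real m + 1"
        by (metis (mono_tags) of_nat_1 of_nat_add of_nat_mult of_nat_numeral of_nat_power)
      then show "?sgr = ereal (((real n + 1)^2 + 1) / 2)" unfolding s m by simp
    qed
  qed
qed

end
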